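(* Let $G\in\mathcal{QD}1$ with torsion part $T=T(G)$, let $(G,\times)$ be a ring on $G$, and let $g\in G$. Let $(g)_\times$ denote the ideal of $(G,\times)$ generated by $g$. 1) If $g\in T(G)$, then $(g)_\times=T(\mathrm{char}\,g)$. In addition, $T(\mathrm{char}\,g)=G(\mathrm{char}\,g)$ if and only if $G\in\mathcal{RQD}1$. 2) If $g\notin T(G)$ and $G\times G\nsubseteq T(G)$, then $(g)_\times=G(\mathrm{char}\,g)$. 3) If $g\notin T(G)$ and $G\times G\subseteq T(G)$, then $(g)_\times=\bigoplus_{p\in P}p^{h_p(g\times e)}T_p(G)+\mathbb{Z}g$, where $\{e\}$ is a basis of $G$.
   Context: All groups are abelian, written additively; $P$ is the set of all primes. $T(G)$ is the torsion part of $G$ and $T_p(G)$ its $p$-primary component. A group $G$ is quotient divisible if it contains no nonzero divisible torsion subgroup but contains a free subgroup $F$ of finite rank such that $G/F$ is a divisible torsion group; a basis of the free group $F$ is called a basis of the quotient divisible group $G$. $\mathcal{QD}1$ is the class of all quotient divisible groups of torsion-free rank 1 (so a basis is a single element $\{e\}$ with $\mathbb{Z}e$ infinite cyclic and $G/\mathbb{Z}e$ divisible torsion), and $\mathcal{RQD}1$ is the class of all reduced groups (no nonzero divisible subgroups) in $\mathcal{QD}1$. A multiplication on $G$ is a homomorphism $\mu:G\otimes G\to G$, written $g_1\times g_2=\mu(g_1\otimes g_2)$; a ring $(G,\times)$ on $G$ is $G$ equipped with a multiplication $\times$ (associativity, commutativity and a unit are not required). $G\times G$ is the subgroup generated by all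 products. An ideal is a two-sided ideal. For $g\in G$, $h_p(g)\in\{0,1,2,\ldots,\infty\}$ is the $p$-height of $g$ in $G$, and $\mathrm{char}\,g$ is the function $P\to\{0,1,2,\ldots,\infty\}$, $p\mapsto h_p(g)$. Such functions are compared pointwise. For a group $A$ and a function $\eta:P\to\{0,1,2,\ldots,\infty\}$, $A(\eta)=\{x\in A\mid \mathrm{char}\,x\ge\eta\}$, characteristics of $x$ being computed in $A$. For groups in $\mathcal{QD}1$ each $T_p(G)$ is a finite cyclic group; $p^\infty T_p(G)=\bigcap_n p^nT_p(G)=0$. *)

theory Defs
  imports
    "HOL-Algebra.Algebra"
    "HOL-Library.Extended_Nat"
    "HOL-Computational_Algebra.Primes"
begin

text \<open>
  Abelian groups are \<open>comm_group\<close>s of HOL-Algebra. Their notation is multiplicative, so the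
  additive \<open>g + h\<close>, \<open>0\<close>, \<open>n g\<close>, \<open>\<int>g\<close> and \<open>A + B\<close> read \<open>g \<otimes> h\<close>, \<open>\<one>\<close>, \<open>g [^] n\<close>,
  \<open>generate G {g}\<close> and \<open>A <#> B\<close>. A subgroup \<open>D\<close>, regarded as a group in its own right, is
  \<open>G\<lparr>carrier := D\<rparr>\<close>.
\<close>

section \<open>Torsion, divisibility, rank\<close>

definition torsion_part :: "('a, 'b) monoid_scheme \<Rightarrow> 'a set" where
  "torsion_part G = {x \<in> carrier G. \<exists>n::nat. n > 0 \<and> x [^]\<^bsub>G\<^esub> n = \<one>\<^bsub>G\<^esub>}"

definition primary_part :: "('a, 'b) monoid_scheme \<Rightarrow> nat \<Rightarrow> 'a set" where
  "primary_part G p = {x \<in> carrier G. \<exists>n::nat. x [^]\<^bsub>G\<^esub> (p ^ n) = \<one>\<^bsub>G\<^esub>}"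

definition torsion_group :: "('a, 'b) monoid_scheme \<Rightarrow> bool" where
  "torsion_group G \<longleftrightarrow> torsion_part G = carrier G"

definition divisible_group :: "('a, 'b) monoid_scheme \<Rightarrow> bool" where
  "divisible_group G \<longleftrightarrow>
     (\<forall>x\<in>carrier G. \<forall>n::nat. n > 0 \<longrightarrow> (\<exists>y\<in>carrier G. y [^]\<^bsub>G\<^esub> n = x))"

definition reduced_group :: "('a, 'b) monoid_scheme \<Rightarrow> bool" where
  "reduced_group G \<longleftrightarrow>
     (\<forall>D. subgroup D G \<and> divisible_group (G\<lparr>carrier := D\<rparr>) \<longrightarrow> D = {\<one>\<^bsub>G\<^esub>})"

text \<open>Linear independence over the integers; in particular every member has infinite order.\<close>

definition int_independent :: "('a, 'b) monoid_scheme \<Rightarrow> 'a set \<Rightarrow> bool" where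
  "int_independent G B \<longleftrightarrow> B \<subseteq> carrier G \<and>
     (\<forall>C (n :: 'a \<Rightarrow> int). C \<subseteq> B \<and> finite C \<and> (\<Otimes>\<^bsub>G\<^esub>b\<in>C. b [^]\<^bsub>G\<^esub> n b) = \<one>\<^bsub>G\<^esub>
        \<longrightarrow> (\<forall>b\<in>C. n b = 0))"

text \<open>The torsion-free rank is the cardinality of a maximal independent set.\<close>

definition has_torsion_free_rank :: "('a, 'b) monoid_scheme \<Rightarrow> nat \<Rightarrow> bool" where
  "has_torsion_free_rank G r \<longleftrightarrow>
     (\<exists>B. finite B \<and> card B = r \<and> int_independent G B \<and>
        (\<forall>x \<in> carrier G - B. \<not> int_independent G (insert x B)))"

section \<open>Quotient divisible groups\<close>

text \<open>
  \<open>B\<close> is a finite basis of the free subgroup \<open>F = generate G B\<close>, and \<open>G / F\<close> is a divisible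
  torsion group.
\<close>

definition qd_basis :: "('a, 'b) monoid_scheme \<Rightarrow> 'a set \<Rightarrow> bool" where
  "qd_basis G B \<longleftrightarrow> finite B \<and> int_independent G B \<and>
     divisible_group (G Mod generate G B) \<and> torsion_group (G Mod generate G B)"

definition quotient_divisible :: "('a, 'b) monoid_scheme \<Rightarrow> bool" where
  "quotient_divisible G \<longleftrightarrow> comm_group G \<and>
     (\<forall>D. subgroup D G \<and> divisible_group (G\<lparr>carrier := D\<rparr>) \<and> torsion_group (G\<lparr>carrier := D\<rparr>)
        \<longrightarrow> D = {\<one>\<^bsub>G\<^esub>}) \<and>
     (\<exists>B. qd_basis G B)"

definition QD1 :: "('a, 'b) monoid_scheme \<Rightarrow> bool" where
  "QD1 G \<longleftrightarrow> quotient_divisible G \<and> has_torsion_free_rank G 1"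

definition RQD1 :: "('a, 'b) monoid_scheme \<Rightarrow> bool" where
  "RQD1 G \<longleftrightarrow> QD1 G \<and> reduced_group G"

section \<open>Heights and characteristics\<close>

definition height :: "('a, 'b) monoid_scheme \<Rightarrow> nat \<Rightarrow> 'a \<Rightarrow> enat" where
  "height G p g = Sup {enat n | n. \<exists>y\<in>carrier G. y [^]\<^bsub>G\<^esub> (p ^ n) = g}"

text \<open>
  A characteristic is represented by a function on all naturals, of which only the values at
  primes are ever used.
\<close>

definition characteristic :: "('a, 'b) monoid_scheme \<Rightarrow> 'a \<Rightarrow> nat \<Rightarrow> enat" where
  "characteristic G g = (\<lambda>p. height G p g)"

definition char_le :: "(nat \<Rightarrow> enat) \<Rightarrow> (nat \<Rightarrow> enat) \<Rightarrow> bool" where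
  "char_le \<eta> \<chi> \<longleftrightarrow> (\<forall>p. Factorial_Ring.prime p \<longrightarrow> \<eta> p \<le> \<chi> p)"

definition char_subgroup :: "('a, 'b) monoid_scheme \<Rightarrow> (nat \<Rightarrow> enat) \<Rightarrow> 'a set" where
  "char_subgroup A \<eta> = {x \<in> carrier A. char_le \<eta> (characteristic A x)}"

text \<open>The subgroup \<open>p\<^sup>kA\<close>, where \<open>p\<^sup>\<infinity>A\<close> is the intersection of all \<open>p\<^sup>nA\<close>.\<close>

definition prime_power_multiple :: "('a, 'b) monoid_scheme \<Rightarrow> nat \<Rightarrow> enat \<Rightarrow> 'a set \<Rightarrow> 'a set" where
  "prime_power_multiple G p k A =
     (case k of
        enat n \<Rightarrow> (\<lambda>x. x [^]\<^bsub>G\<^esub> (p ^ n)) ` A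
      | \<infinity> \<Rightarrow> (\<Inter>n::nat. (\<lambda>x. x [^]\<^bsub>G\<^esub> (p ^ n)) ` A))"

definition internal_direct_sum ::
  "('a, 'b) monoid_scheme \<Rightarrow> 'i set \<Rightarrow> ('i \<Rightarrow> 'a set) \<Rightarrow> 'a set \<Rightarrow> bool" where
  "internal_direct_sum G I A S \<longleftrightarrow>
     (\<forall>i\<in>I. subgroup (A i) G) \<and> S = generate G (\<Union>i\<in>I. A i) \<and>
     (\<forall>i\<in>I. A i \<inter> generate G (\<Union>j\<in>I - {i}. A j) = {\<one>\<^bsub>G\<^esub>})"

section \<open>Tensor products and multiplications\<close>

definition tensor_relations ::
  "('a, 'c) monoid_scheme \<Rightarrow> ('b, 'd) monoid_scheme \<Rightarrow> ('a \<times> 'b \<Rightarrow>\<^sub>0 int) set" where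
  "tensor_relations G H =
     {frag_of (x \<otimes>\<^bsub>G\<^esub> x', y) - frag_of (x, y) - frag_of (x', y) | x x' y.
        x \<in> carrier G \<and> x' \<in> carrier G \<and> y \<in> carrier H} \<union>
     {frag_of (x, y \<otimes>\<^bsub>H\<^esub> y') - frag_of (x, y) - frag_of (x, y') | x y y'.
        x \<in> carrier G \<and> y \<in> carrier H \<and> y' \<in> carrier H}"

definition tensor_kernel ::
  "('a, 'c) monoid_scheme \<Rightarrow> ('b, 'd) monoid_scheme \<Rightarrow> ('a \<times> 'b \<Rightarrow>\<^sub>0 int) set" where
  "tensor_kernel G H =
     generate (free_Abelian_group (carrier G \<times> carrier H)) (tensor_relations G H)"

definition tensor_product ::
  "('a, 'c) monoid_scheme \<Rightarrow> ('b, 'd) monoid_scheme \<Rightarrow> ('a \<times> 'b \<Rightarrow>\<^sub>0 int) set monoid" where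
  "tensor_product G H = free_Abelian_group (carrier G \<times> carrier H) Mod tensor_kernel G H"

definition pure_tensor ::
  "('a, 'c) monoid_scheme \<Rightarrow> ('b, 'd) monoid_scheme \<Rightarrow> 'a \<Rightarrow> 'b \<Rightarrow> ('a \<times> 'b \<Rightarrow>\<^sub>0 int) set" where
  "pure_tensor G H x y =
     tensor_kernel G H #>\<^bsub>free_Abelian_group (carrier G \<times> carrier H)\<^esub> frag_of (x, y)"

text \<open>A ring on \<open>G\<close> is a homomorphism \<open>\<mu> \<in> hom (tensor_product G G) G\<close>; this is its product.\<close>

definition ring_prod ::
  "('a, 'c) monoid_scheme \<Rightarrow> (('a \<times> 'a \<Rightarrow>\<^sub>0 int) set \<Rightarrow> 'a) \<Rightarrow> 'a \<Rightarrow> 'a \<Rightarrow> 'a" where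
  "ring_prod G \<mu> x y = \<mu> (pure_tensor G G x y)"

definition ring_square ::
  "('a, 'c) monoid_scheme \<Rightarrow> (('a \<times> 'a \<Rightarrow>\<^sub>0 int) set \<Rightarrow> 'a) \<Rightarrow> 'a set" where
  "ring_square G \<mu> = generate G {ring_prod G \<mu> x y | x y. x \<in> carrier G \<and> y \<in> carrier G}"

definition ring_ideal ::
  "('a, 'c) monoid_scheme \<Rightarrow> (('a \<times> 'a \<Rightarrow>\<^sub>0 int) set \<Rightarrow> 'a) \<Rightarrow> 'a set \<Rightarrow> bool" where
  "ring_ideal G \<mu> I \<longleftrightarrow> subgroup I G \<and>
     (\<forall>a\<in>I. \<forall>x\<in>carrier G. ring_prod G \<mu> x a \<in> I \<and> ring_prod G \<mu> a x \<in> I)"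

definition principal_ring_ideal ::
  "('a, 'c) monoid_scheme \<Rightarrow> (('a \<times> 'a \<Rightarrow>\<^sub>0 int) set \<Rightarrow> 'a) \<Rightarrow> 'a \<Rightarrow> 'a set" where
  "principal_ring_ideal G \<mu> g = \<Inter>{I. ring_ideal G \<mu> I \<and> g \<in> I}"

text \<open>
  The products of rings on \<open>G\<close> are exactly the biadditive operations on \<open>carrier G\<close>.
\<close>

lemma keys_frag_diff3: "a \<in> S \<Longrightarrow> b \<in> S \<Longrightarrow> d \<in> S \<Longrightarrow> Poly_Mapping.keys (frag_of a - frag_of b - frag_of d) \<subseteq> S"
  using keys_diff[of "frag_of a - frag_of b" "frag_of d"] keys_diff[of "frag_of a" "frag_of b"] by auto

lemma tensor_kernel_subgroup:
  assumes "comm_group G" "comm_group H"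
  shows "tensor_kernel G H \<lhd> free_Abelian_group (carrier G \<times> carrier H)"
proof -
  interpret G: comm_group G by fact
  interpret H: comm_group H by fact
  let ?F = "free_Abelian_group (carrier G \<times> carrier H)"
  interpret F: comm_group ?F by (rule abelian_free_Abelian_group)
  have "tensor_relations G H \<subseteq> carrier ?F"
  proof
    fix w assume "w \<in> tensor_relations G H"
    then obtain a b d where "w = frag_of a - frag_of b - frag_of d" "a \<in> carrier G \<times> carrier H"
      "b \<in> carrier G \<times> carrier H" "d \<in> carrier G \<times> carrier H"
      unfolding tensor_relations_def by fastforce
    then show "w \<in> carrier ?F" using keys_frag_diff3 by simp
  qed
  then show ?thesis unfolding tensor_kernel_def
    by (intro F.subgroup_imp_normal F.generate_is_subgroup)
qed

lemma ring_prod_biadditive: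
  assumes "comm_group G" and mu: "\<mu> \<in> hom (tensor_product G G) G"
    and x: "x \<in> carrier G" and y: "y \<in> carrier G" and z: "z \<in> carrier G"
  shows "ring_prod G \<mu> x y \<in> carrier G"
    and "ring_prod G \<mu> (x \<otimes>\<^bsub>G\<^esub> y) z = ring_prod G \<mu> x z \<otimes>\<^bsub>G\<^esub> ring_prod G \<mu> y z"
    and "ring_prod G \<mu> z (x \<otimes>\<^bsub>G\<^esub> y) = ring_prod G \<mu> z x \<otimes>\<^bsub>G\<^esub> ring_prod G \<mu> z y"
proof -
  interpret G: comm_group G by fact
  let ?F = "free_Abelian_group (carrier G \<times> carrier G)"
  let ?K = "tensor_kernel G G"
  interpret F: comm_group ?F by (rule abelian_free_Abelian_group)
  interpret K: normal ?K ?F using tensor_kernel_subgroup assms(1) by blast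
  have c: "frag_of (a, b) \<in> carrier ?F" if "a \<in> carrier G" "b \<in> carrier G" for a b
    using that by simp
  have pc: "pure_tensor G G a b \<in> carrier (tensor_product G G)"
    if "a \<in> carrier G" "b \<in> carrier G" for a b
    using that c[OF that] unfolding pure_tensor_def tensor_product_def FactGroup_def RCOSETS_def by auto
  show cl: "ring_prod G \<mu> x y \<in> carrier G"
    unfolding ring_prod_def using mu pc x y by (auto simp: hom_def)
  have key: "\<mu> (?K #>\<^bsub>?F\<^esub> frag_of a) = \<mu> (?K #>\<^bsub>?F\<^esub> frag_of b) \<otimes>\<^bsub>G\<^esub> \<mu> (?K #>\<^bsub>?F\<^esub> frag_of d)"
    if r: "frag_of a - frag_of b - frag_of d \<in> ?K" 
      and m: "a \<in> carrier G \<times> carrier G" "b \<in> carrier G \<times> carrier G" "d \<in> carrier G \<times> carrier G" for a b d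
  proof -
    have cc: "frag_of a \<in> carrier ?F" "frag_of b \<in> carrier ?F" "frag_of d \<in> carrier ?F"
      using m by simp_all
    have bd: "frag_of b + frag_of d \<in> carrier ?F" using F.m_closed[OF cc(2,3)] by simp
    have "frag_of a = (frag_of a - frag_of b - frag_of d) \<otimes>\<^bsub>?F\<^esub> (frag_of b + frag_of d)" by simp
    then have "frag_of a \<in> ?K #>\<^bsub>?F\<^esub> (frag_of b + frag_of d)"
      using r unfolding r_coset_def by blast
    then have "?K #>\<^bsub>?F\<^esub> frag_of a = ?K #>\<^bsub>?F\<^esub> (frag_of b + frag_of d)"
      using F.repr_independence[OF _ bd K.is_subgroup] by simp
    also have "\<dots> = (?K #>\<^bsub>?F\<^esub> frag_of b) <#>\<^bsub>?F\<^esub> (?K #>\<^bsub>?F\<^esub> frag_of d)"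
      using K.rcos_sum[OF cc(2,3)] by simp
    finally have "\<mu> (?K #>\<^bsub>?F\<^esub> frag_of a) =
       \<mu> ((?K #>\<^bsub>?F\<^esub> frag_of b) \<otimes>\<^bsub>tensor_product G G\<^esub> (?K #>\<^bsub>?F\<^esub> frag_of d))"
      by (simp add: tensor_product_def)
    moreover have "?K #>\<^bsub>?F\<^esub> frag_of b \<in> carrier (tensor_product G G)" 
       "?K #>\<^bsub>?F\<^esub> frag_of d \<in> carrier (tensor_product G G)"
      using cc unfolding tensor_product_def FactGroup_def RCOSETS_def by auto
    ultimately show ?thesis using hom_mult[OF mu] by simp
  qed
  have "frag_of (x \<otimes>\<^bsub>G\<^esub> y, z) - frag_of (x, z) - frag_of (y, z) \<in> ?K"
    "frag_of (z, x \<otimes>\<^bsub>G\<^esub> y) - frag_of (z, x) - frag_of (z, y) \<in> ?K"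
    unfolding tensor_kernel_def using x y z
    by (auto intro!: generate.incl simp: tensor_relations_def)
  from this[THEN key] x y z
  show "ring_prod G \<mu> (x \<otimes>\<^bsub>G\<^esub> y) z = ring_prod G \<mu> x z \<otimes>\<^bsub>G\<^esub> ring_prod G \<mu> y z"
    "ring_prod G \<mu> z (x \<otimes>\<^bsub>G\<^esub> y) = ring_prod G \<mu> z x \<otimes>\<^bsub>G\<^esub> ring_prod G \<mu> z y"
    unfolding ring_prod_def pure_tensor_def by auto
qed

lemma biadditive_ring_prod:
  assumes "comm_group G"
    and cl: "\<And>x y. x \<in> carrier G \<Longrightarrow> y \<in> carrier G \<Longrightarrow> f x y \<in> carrier G"
    and l: "\<And>x y z. x \<in> carrier G \<Longrightarrow> y \<in> carrier G \<Longrightarrow> z \<in> carrier G \<Longrightarrow>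
              f (x \<otimes>\<^bsub>G\<^esub> y) z = f x z \<otimes>\<^bsub>G\<^esub> f y z"
    and r: "\<And>x y z. x \<in> carrier G \<Longrightarrow> y \<in> carrier G \<Longrightarrow> z \<in> carrier G \<Longrightarrow>
              f z (x \<otimes>\<^bsub>G\<^esub> y) = f z x \<otimes>\<^bsub>G\<^esub> f z y"
  obtains \<mu> where "\<mu> \<in> hom (tensor_product G G) G"
    and "\<And>x y. x \<in> carrier G \<Longrightarrow> y \<in> carrier G \<Longrightarrow> ring_prod G \<mu> x y = f x y"
proof -
  interpret G: comm_group G by fact
  let ?F = "free_Abelian_group (carrier G \<times> carrier G)"
  let ?K = "tensor_kernel G G"
  interpret F: comm_group ?F by (rule abelian_free_Abelian_group)
  interpret K: normal ?K ?F using tensor_kernel_subgroup assms(1) by blast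
  obtain h where h: "h \<in> hom ?F G"
    "\<And>x. x \<in> carrier G \<times> carrier G \<Longrightarrow> h (frag_of x) = (\<lambda>(x, y). f x y) x"
    by (rule G.free_Abelian_group_universal[of "\<lambda>(x, y). f x y" "carrier G \<times> carrier G"])
       (use cl in auto)
  interpret h: group_hom ?F G h
    by (simp add: h(1) group_hom_axioms_def group_hom_def)
  have hr: "h (frag_of a - frag_of b - frag_of d) = \<one>\<^bsub>G\<^esub>"
    if m: "a \<in> carrier G \<times> carrier G" "b \<in> carrier G \<times> carrier G" "d \<in> carrier G \<times> carrier G"
      and e: "h (frag_of a) = h (frag_of b) \<otimes>\<^bsub>G\<^esub> h (frag_of d)" for a b d
  proof -
    let ?w = "frag_of a - frag_of b - frag_of d"
    have cc: "frag_of a \<in> carrier ?F" "frag_of b \<in> carrier ?F" "frag_of d \<in> carrier ?F"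
      using m by simp_all
    have bd: "frag_of b + frag_of d \<in> carrier ?F" using F.m_closed[OF cc(2,3)] by simp
    have "Poly_Mapping.keys ?w \<subseteq> carrier G \<times> carrier G"
      using m keys_diff[of "frag_of a - frag_of b" "frag_of d"] keys_diff[of "frag_of a" "frag_of b"] by auto
    then have w: "?w \<in> carrier ?F" by simp
    have "frag_of a = ?w \<otimes>\<^bsub>?F\<^esub> (frag_of b \<otimes>\<^bsub>?F\<^esub> frag_of d)" by simp
    then have "h (frag_of a) = h ?w \<otimes>\<^bsub>G\<^esub> (h (frag_of b) \<otimes>\<^bsub>G\<^esub> h (frag_of d))"
      using h.hom_mult w bd cc by (metis mult_free_Abelian_group)
    then have "h (frag_of a) \<otimes>\<^bsub>G\<^esub> h ?w = h (frag_of a)" using e h.hom_closed[OF w] h.hom_closed[OF cc(1)] by (simp add: G.m_comm)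
    then show ?thesis using h.hom_closed[OF w] h.hom_closed[OF cc(1)]
      by (simp add: G.l_cancel_one)
  qed
  have "tensor_relations G G \<subseteq> kernel ?F G h"
  proof -
    have "tensor_relations G G \<subseteq> carrier ?F"
    proof
      fix w assume "w \<in> tensor_relations G G"
      then have "w \<in> ?K" unfolding tensor_kernel_def by (rule generate.incl)
      then show "w \<in> carrier ?F" using K.subset by blast
    qed
    moreover have "h w = \<one>\<^bsub>G\<^esub>" if "w \<in> tensor_relations G G" for w
      using that unfolding tensor_relations_def
      by (auto intro!: hr simp: h(2) l r)
    ultimately show ?thesis unfolding kernel_def by blast
  qed
  then have K: "?K \<subseteq> kernel ?F G h"
    unfolding tensor_kernel_def using F.generate_subgroup_incl h.subgroup_kernel by blast
  have inv: "h a = h b" if ab: "a \<in> carrier ?F" "b \<in> carrier ?F" "?K #>\<^bsub>?F\<^esub> a = ?K #>\<^bsub>?F\<^esub> b" for a b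
  proof -
    have "a \<in> ?K #>\<^bsub>?F\<^esub> b" using ab F.rcos_self K.is_subgroup by blast
    then obtain k where k: "k \<in> ?K" "a = k \<otimes>\<^bsub>?F\<^esub> b" unfolding r_coset_def by auto
    then have "h k = \<one>\<^bsub>G\<^esub>" "k \<in> carrier ?F" using K by (auto simp: kernel_def)
    with k ab show ?thesis by (metis G.l_one h.hom_closed h.hom_mult)
  qed
  obtain \<mu> where mu: "\<mu> \<in> hom (?F Mod ?K) G" "\<And>x. x \<in> carrier ?F \<Longrightarrow> \<mu> (?K #>\<^bsub>?F\<^esub> x) = h x"
    using FactGroup_universal[OF h(1) K.normal_axioms inv] by blast
  show thesis
  proof
    show "\<mu> \<in> hom (tensor_product G G) G" using mu by (simp add: tensor_product_def)
    show "ring_prod G \<mu> x y = f x y" if "x \<in> carrier G" "y \<in> carrier G" for x y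
      using that by (simp add: ring_prod_def pure_tensor_def mu h(2))
  qed
qed

end

theory Submission
  imports Defs
begin

text \<open>
  Comments use additive notation: \<open>n x\<close> for \<open>x [^] n\<close>, \<open>\<int>x\<close> for \<open>generate G {x}\<close>, \<open>nG\<close> for
  \<open>multiples G n\<close>, \<open>T\<close> and \<open>T\<^sub>p\<close> for the torsion part and its primary components, and \<open>\<star>\<close> for the
  product of the ring.

  The memberships \<open>x \<in> I\<close> in a subgroup on which the theorem rests are proved one prime at a time: it suffices to find, for each prime \<open>p\<close>, a number \<open>m\<close> prime to \<open>p\<close> with \<open>m x \<in> I\<close>
  (\<open>mem_subgroup_local_global\<close>). What the group looks like at \<open>p\<close> follows from \<open>G = \<int>e + nG\<close> and
  the absence of divisible torsion subgroups. If \<open>T\<^sub>p \<noteq> 0\<close>, then \<open>T\<^sub>p\<close> has an element \<open>b\<close> outside \<open>pG\<close>, and since \<open>G/pG\<close> is cyclic, \<open>G = \<int>b + pG\<close>.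
  Iterating, \<open>G = \<int>b + p\<^sup>kG\<close> where \<open>p\<^sup>k b = 0\<close>; hence \<open>p\<^sup>kG = p\<^sup>k\<^sup>+\<^sup>1G\<close>, and \<open>p\<^sup>kT\<^sub>p\<close> is divisible, so it is
  zero. Thus \<open>G\<close> is the direct sum of the finite cyclic group \<open>\<int>b = T\<^sub>p\<close> and of \<open>H = p\<^sup>kG\<close>, which is
  \<open>p\<close>-divisible and without \<open>p\<close>-torsion (\<open>splits_at_if_torsion\<close>). If \<open>T\<^sub>p = 0\<close>, there is nothing to split off,
  and either \<open>G = pG\<close>, which is the same picture with \<open>H = G\<close>, or every element of infinite order has
  finite \<open>p\<close>-height. Where \<open>G\<close> splits, an element \<open>x\<close> with \<open>h\<^sub>p(x) \<ge> h\<^sub>p(g)\<close> agrees modulo \<open>H\<close> with a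
  multiple of \<open>g\<close> (\<open>splits_at_height_le\<close>); this reduces everything to elements of \<open>H\<close>.

  For \<open>g \<in> T\<close> this gives \<open>T(char g) = \<int>g\<close> (\<open>torsion_char_subgroup\<close>), because torsion elements of \<open>H\<close>
  have order prime to \<open>p\<close>. Multiplication by a ring element is an endomorphism and does not lower heights,
  so \<open>T(char g)\<close> is an ideal, and it is the one generated by \<open>g\<close>. Moreover, if \<open>n g = 0\<close>, every element of
  \<open>n G(char g)\<close> has infinite height at all primes, and the elements of that kind form the
  largest divisible subgroup \<open>D\<close> of \<open>G\<close>. As \<open>D\<close> lies in \<open>G(char g)\<close> and is not torsion unless \<open>D = 0\<close>, the
  group \<open>G(char g)\<close> is torsion exactly when \<open>G\<close> is reduced.

  Let \<open>g \<notin> T\<close>, and let some product have infinite order. Then \<open>x \<star> g \<notin> T\<close> for some \<open>x\<close>, and where \<open>G\<close>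
  splits, \<open>H \<star> g\<close> is a \<open>p\<close>-divisible part of the ideal that contains, up to factors prime to \<open>p\<close>, all of
  \<open>H\<close>. Where \<open>T\<^sub>p = 0\<close> and \<open>h\<^sub>p(g)\<close> is finite, \<open>x\<close> is itself a multiple of \<open>g\<close> up to such a factor.

  If all products are torsion, put \<open>w = g \<star> e\<close>. Modulo each \<open>nG\<close> all elements are multiples of \<open>e\<close>, so
  the ring is commutative there, and every product with the factor \<open>g\<close> is a multiple of \<open>w\<close> modulo \<open>nG\<close>. Such products
  therefore lie in \<open>T(char w) = \<int>w\<close>, which makes \<open>\<int>w + \<int>g\<close> an ideal; and the direct sum of the
  groups \<open>p\<^bsup>h(w)\<^esup>T\<^sub>p\<close>, the height \<open>h(w)\<close> being taken at \<open>p\<close>, is \<open>T(char w)\<close> once more.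
\<close>

section \<open>Torsion and divisibility in abelian groups\<close>

definition multiples :: "('a, 'b) monoid_scheme \<Rightarrow> nat \<Rightarrow> 'a set" where
  "multiples G n = (\<lambda>y. y [^]\<^bsub>G\<^esub> n) ` carrier G"

lemma prime_power_split:
  assumes "Factorial_Ring.prime (p::nat)" "m > 0"
  obtains j m' where "m = p ^ j * m'" "\<not> p dvd m'"
proof -
  have "\<not> is_unit p" "m \<noteq> 0" using assms not_prime_unit by auto
  then show thesis using multiplicity_decompose' that by metis
qed

context comm_group
begin

lemma subgroup_pow_image:
  assumes "subgroup A G"
  shows "subgroup ((\<lambda>y. y [^] (n::nat)) ` A) G"
proof (rule subgroupI)
  note A = subgroup.mem_carrier[OF assms]
  show "(\<lambda>y. y [^] n) ` A \<subseteq> carrier G" using A by auto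
  show "(\<lambda>y. y [^] n) ` A \<noteq> {}" using subgroup.one_closed[OF assms] by auto
  show "inv a \<in> (\<lambda>y. y [^] n) ` A" if "a \<in> (\<lambda>y. y [^] n) ` A" for a
    using that A by (auto simp: nat_pow_inv[symmetric] subgroup.m_inv_closed[OF assms])
  show "a \<otimes> b \<in> (\<lambda>y. y [^] n) ` A"
    if "a \<in> (\<lambda>y. y [^] n) ` A" "b \<in> (\<lambda>y. y [^] n) ` A" for a b
    using that A by (auto simp: nat_pow_distrib[symmetric] subgroup.m_closed[OF assms])
qed

lemma subgroup_multiples: "subgroup (multiples G n) G"
  unfolding multiples_def by (rule subgroup_pow_image) (rule subgroup_self)

lemma multiplesI: "y \<in> carrier G \<Longrightarrow> y [^] n \<in> multiples G n"
  by (simp add: multiples_def)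

lemma multiples_int_powI: "y \<in> carrier G \<Longrightarrow> y [^] (int n * i) \<in> multiples G n"
  using multiplesI[of "y [^] i" n]
  by (simp add: int_pow_int[symmetric] int_pow_pow mult.commute)

lemma multiples_carrier: "x \<in> multiples G n \<Longrightarrow> x \<in> carrier G"
  by (auto simp: multiples_def)

lemma multiples_one [simp]: "multiples G (Suc 0) = carrier G"
  unfolding multiples_def by (auto simp: image_iff) 

lemma multiples_dvd_mono:
  assumes "m dvd n" shows "multiples G n \<subseteq> multiples G m"
proof
  fix x assume "x \<in> multiples G n"
  then obtain y where y: "y \<in> carrier G" "x = y [^] n" by (auto simp: multiples_def)
  obtain k where "n = k * m" using assms by (metis dvd_div_mult_self)
  then have "x = (y [^] k) [^] m" using y by (simp add: nat_pow_pow)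
  then show "x \<in> multiples G m" using y multiplesI by simp
qed

lemma pow_mult_one:
  assumes "x \<in> carrier G" "x [^] (m::nat) = \<one>"
  shows "x [^] (m * n) = \<one>" "x [^] (n * m) = \<one>"
  using assms nat_pow_pow[of x m n] by (simp_all add: mult.commute)

lemma subgroup_torsion_part: "subgroup (torsion_part G) G"
proof (rule subgroupI)
  show "torsion_part G \<noteq> {}"
    unfolding torsion_part_def using nat_pow_one[of 1] by blast
  show "inv a \<in> torsion_part G" if "a \<in> torsion_part G" for a
    using that by (auto simp: torsion_part_def nat_pow_inv)
  show "a \<otimes> b \<in> torsion_part G" if "a \<in> torsion_part G" "b \<in> torsion_part G" for a b
  proof -
    from that obtain m n :: nat where "a \<in> carrier G" "b \<in> carrier G" "m > 0" "n > 0"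
      "a [^] m = \<one>" "b [^] n = \<one>" by (auto simp: torsion_part_def)
    then have "(a \<otimes> b) [^] (m * n) = \<one>" "m * n > 0"
      by (simp_all add: nat_pow_distrib pow_mult_one)
    then show ?thesis using \<open>a \<in> carrier G\<close> \<open>b \<in> carrier G\<close> unfolding torsion_part_def by blast
  qed
qed (auto simp: torsion_part_def)

lemma subgroup_primary_part: "subgroup (primary_part G p) G"
proof (rule subgroupI)
  show "primary_part G p \<noteq> {}"
    unfolding primary_part_def using nat_pow_one[of 1] by auto
  show "inv a \<in> primary_part G p" if "a \<in> primary_part G p" for a
    using that by (auto simp: primary_part_def nat_pow_inv)
  show "a \<otimes> b \<in> primary_part G p" if "a \<in> primary_part G p" "b \<in> primary_part G p" for a b
  proof -
    from that obtain m n :: nat where "a \<in> carrier G" "b \<in> carrier G"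
      "a [^] (p ^ m) = \<one>" "b [^] (p ^ n) = \<one>" by (auto simp: primary_part_def)
    then have "(a \<otimes> b) [^] (p ^ (m + n)) = \<one>"
      by (simp add: nat_pow_distrib pow_mult_one power_add)
    then show ?thesis using \<open>a \<in> carrier G\<close> \<open>b \<in> carrier G\<close> unfolding primary_part_def by blast
  qed
qed (auto simp: primary_part_def)

lemma torsion_part_pow_iff:
  assumes "x \<in> carrier G" "n > 0"
  shows "x [^] (n::nat) \<in> torsion_part G \<longleftrightarrow> x \<in> torsion_part G"
proof
  assume "x [^] n \<in> torsion_part G"
  then obtain m :: nat where "m > 0" "(x [^] n) [^] m = \<one>" by (auto simp: torsion_part_def)
  then have "n * m > 0" "x [^] (n * m) = \<one>" using assms by (simp_all add: nat_pow_pow)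
  then show "x \<in> torsion_part G" using assms(1) unfolding torsion_part_def by blast
next
  assume "x \<in> torsion_part G"
  then show "x [^] n \<in> torsion_part G"
    using subgroup_int_pow_closed[OF subgroup_torsion_part, of x "int n"] by (simp add: int_pow_int)
qed

lemma primary_part_pow_imp:
  assumes "x \<in> carrier G" "x [^] (p ^ n) \<in> primary_part G p"
  shows "x \<in> primary_part G p"
  using assms by (auto simp: primary_part_def nat_pow_pow power_add[symmetric])

text \<open>Used to recover \<open>x\<close> from \<open>a + x\<close>, and to pass between elements congruent modulo \<open>I\<close>.\<close>
lemma subgroup_m_cancel:
  assumes "subgroup I G" "a \<in> I" "x \<in> carrier G" "a \<otimes> x \<in> I"
  shows "x \<in> I"
proof -
  have "inv a \<otimes> (a \<otimes> x) \<in> I"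
    using assms by (simp add: subgroup.m_closed subgroup.m_inv_closed)
  moreover have "inv a \<otimes> (a \<otimes> x) = x"
    using assms subgroup.mem_carrier by (metis inv_solve_left m_closed)
  ultimately show ?thesis by simp
qed

lemma pow_gcd_mem:
  assumes "subgroup I G" "x \<in> carrier G" "x [^] (m::nat) \<in> I" "x [^] (n::nat) \<in> I"
  shows "x [^] gcd m n \<in> I"
proof -
  obtain u v where uv: "u * int m + v * int n = gcd (int m) (int n)" using bezout_int by blast
  have "(x [^] m) [^] u \<otimes> (x [^] n) [^] v \<in> I"
    using assms by (intro subgroup.m_closed[OF assms(1)] subgroup_int_pow_closed) auto
  also have "(x [^] m) [^] u \<otimes> (x [^] n) [^] v = x [^] gcd (int m) (int n)"
    using assms(2) by (simp add: int_pow_int[symmetric] int_pow_pow int_pow_mult[symmetric] uv mult.commute[of "int m"] mult.commute[of "int n"])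
  finally show ?thesis by (simp add: int_pow_int)
qed

lemma coprime_pow_mem:
  assumes "subgroup I G" "x \<in> carrier G" "x [^] (m::nat) \<in> I" "x [^] (n::nat) \<in> I" "coprime m n"
  shows "x \<in> I"
  using pow_gcd_mem[OF assms(1-4)] assms by simp

text \<open>The \<open>m\<close> with \<open>m x \<in> I\<close> form an ideal of the integers, generated by the least positive one; by
assumption no prime divides the generator, so it is \<open>1\<close>.\<close>
lemma mem_subgroup_local_global:
  assumes I: "subgroup I G" and x: "x \<in> carrier G"
    and loc: "\<And>p. Factorial_Ring.prime p \<Longrightarrow> \<exists>m::nat. \<not> p dvd m \<and> x [^] m \<in> I"
  shows "x \<in> I"
proof -
  define d where "d = (LEAST m::nat. m > 0 \<and> x [^] m \<in> I)"
  obtain m0 :: nat where "\<not> 2 dvd m0" "x [^] m0 \<in> I" using loc[of 2] by auto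
  then have "m0 > 0 \<and> x [^] m0 \<in> I" by (auto intro: gr0I)
  then have d: "d > 0 \<and> x [^] d \<in> I" unfolding d_def by (rule LeastI)
  have dvd: "d dvd m" if "x [^] m \<in> I" for m
  proof -
    have "x [^] gcd d m \<in> I" using pow_gcd_mem I x d that by blast
    then have "d \<le> gcd d m" unfolding d_def
      using d[unfolded d_def] by (intro Least_le) auto
    then show ?thesis using d by (metis dvd_antisym gcd_dvd1 gcd_dvd2 gcd_le1_nat le_antisym neq0_conv)
  qed
  have "d = 1"
  proof (rule ccontr)
    assume "d \<noteq> 1"
    then obtain p where p: "Factorial_Ring.prime p" "p dvd d" using prime_factor_nat by blast
    from loc[OF p(1)] dvd p(2) show False using dvd_trans by blast
  qed
  then show ?thesis using d x by simp
qed

lemma multiples_coprime_pow: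
  assumes "x \<in> carrier G" "x [^] (m::nat) \<in> multiples G n" "coprime m n"
  shows "x \<in> multiples G n"
  using coprime_pow_mem[OF subgroup_multiples assms(1,2)] multiplesI assms by blast

text \<open>If \<open>u m + v n = 1\<close> and \<open>m x = 0\<close>, then \<open>x = n (v x)\<close>.\<close>
lemma coprime_order_multiples:
  assumes "x \<in> carrier G" "x [^] (m::nat) = \<one>" "coprime m n"
  shows "x \<in> multiples G n"
  using multiples_coprime_pow[OF assms(1) _ assms(3)] assms(2)
    subgroup.one_closed[OF subgroup_multiples] by simp

text \<open>Multiplying by the part of the order that is prime to \<open>p\<close> leaves the \<open>p\<close>-component.\<close>
lemma torsion_splits_prime:
  assumes p: "Factorial_Ring.prime p" and x: "x \<in> torsion_part G"
  obtains m :: nat where "\<not> p dvd m" "x [^] m \<in> primary_part G p"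
proof -
  from x obtain n :: nat where n: "x \<in> carrier G" "n > 0" "x [^] n = \<one>" by (auto simp: torsion_part_def)
  obtain j m where "n = p ^ j * m" "\<not> p dvd m" using prime_power_split[OF p n(2)] .
  moreover have "x [^] m \<in> primary_part G p"
    using n calculation by (auto simp: primary_part_def nat_pow_pow mult.commute)
  ultimately show thesis using that by blast
qed

lemma primary_part_coprime_pow:
  assumes p: "Factorial_Ring.prime p" and x: "x \<in> primary_part G p"
    and m: "x [^] (m::nat) = \<one>" "\<not> p dvd m"
  shows "x = \<one>"
proof -
  from x obtain n :: nat where n: "x \<in> carrier G" "x [^] (p ^ n) = \<one>" by (auto simp: primary_part_def)
  have "coprime m (p ^ n)" using m(2) p by (metis coprime_commute coprime_power_left_iff prime_imp_coprime)
  then have "x \<in> {\<one>}"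
    using coprime_pow_mem[OF triv_subgroup n(1), of m "p ^ n"] m n by simp
  then show ?thesis by simp
qed

lemma primary_part_subset_torsion:
  assumes "Factorial_Ring.prime p"
  shows "primary_part G p \<subseteq> torsion_part G"
proof
  fix x assume "x \<in> primary_part G p"
  then obtain n :: nat where "x \<in> carrier G" "x [^] (p ^ n) = \<one>" by (auto simp: primary_part_def)
  moreover have "p ^ n > 0" using prime_gt_0_nat[OF assms] by simp
  ultimately show "x \<in> torsion_part G" unfolding torsion_part_def by blast
qed

text \<open>Division by \<open>n\<close> is done one prime factor after the other.\<close>
lemma divisible_subgroupI:
  assumes D: "subgroup D G"
    and step: "\<And>(p::nat) x. Factorial_Ring.prime p \<Longrightarrow> x \<in> D \<Longrightarrow> \<exists>y\<in>D. y [^] p = x"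
  shows "divisible_group (G\<lparr>carrier := D\<rparr>)"
proof -
  have "\<forall>x\<in>D. \<exists>y\<in>D. y [^] n = x" if "n > 0" for n :: nat
    using that
  proof (induction n rule: less_induct)
    case (less n)
    show ?case
    proof (cases "n = 1")
      case True
      then show ?thesis using subgroup.mem_carrier[OF D] by auto
    next
      case False
      then obtain p where p: "Factorial_Ring.prime p" "p dvd n" using prime_factor_nat by blast
      then obtain k where k: "n = p * k" by blast
      have "k > 0" "k < n" using less.prems k prime_gt_1_nat[OF p(1)] by auto
      then have IH: "\<forall>x\<in>D. \<exists>y\<in>D. y [^] k = x" using less.IH by blast
      show ?thesis
      proof
        fix x assume "x \<in> D"
        then obtain y z where "y \<in> D" "y [^] k = x" "z \<in> D" "z [^] p = y"
          using IH step[OF p(1)] by metis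
        then show "\<exists>y\<in>D. y [^] n = x" using k subgroup.mem_carrier[OF D] nat_pow_pow by metis
      qed
    qed
  qed
  then show ?thesis
    unfolding divisible_group_def by (simp flip: nat_pow_consistent)
qed

section \<open>Heights\<close>

text \<open>The exponents \<open>n\<close> for which \<open>p\<^sup>n\<close> divides \<open>x\<close> are downward closed, so the supremum that defines the
height determines them all.\<close>
lemma enat_le_height_iff:
  assumes "x \<in> carrier G" and p: "p > 0"
  shows "enat n \<le> height G p x \<longleftrightarrow> x \<in> multiples G (p ^ n)"
proof
  assume "x \<in> multiples G (p ^ n)"
  then show "enat n \<le> height G p x"
    unfolding height_def multiples_def by (intro Sup_upper) auto
next
  assume le: "enat n \<le> height G p x"
  show "x \<in> multiples G (p ^ n)"
  proof (rule ccontr)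
    assume not: "x \<notin> multiples G (p ^ n)"
    have less: "k < n" if "x \<in> multiples G (p ^ k)" for k
      using not that multiples_dvd_mono[of "p ^ n" "p ^ k"] by (meson le_imp_power_dvd not_less subsetD)
    have "n > 0" using not assms(1) by (cases n) auto
    have "height G p x \<le> enat (n - 1)"
      unfolding height_def
    proof (rule Sup_least)
      fix h assume "h \<in> {enat n | n. \<exists>y\<in>carrier G. y [^] (p ^ n) = x}"
      then obtain k where "h = enat k" "x \<in> multiples G (p ^ k)" by (auto simp: multiples_def)
      then show "h \<le> enat (n - 1)" using less[of k] by simp
    qed
    then have "enat n \<le> enat (n - 1)" using le by (rule order_trans[rotated])
    then show False using \<open>n > 0\<close> by simp
  qed
qed

end

text \<open>Allows heights to be compared through finite exponents only, without separating the value \<open>\<infinity>\<close>.\<close>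
lemma enat_le_iff_finite: "(a::enat) \<le> b \<longleftrightarrow> (\<forall>n. enat n \<le> a \<longrightarrow> enat n \<le> b)"
proof
  assume R: "\<forall>n. enat n \<le> a \<longrightarrow> enat n \<le> b"
  show "a \<le> b"
  proof (cases a)
    case (enat n) then show ?thesis using R by blast
  next
    case infinity
    then have "\<And>n. enat n \<le> b" using R by simp
    then show ?thesis using infinity by (cases b) (auto, meson Suc_n_not_le_n)
  qed
qed auto

context comm_group
begin

lemma char_le_iff:
  assumes "x \<in> carrier G" "y \<in> carrier G"
  shows "char_le (characteristic G y) (characteristic G x) \<longleftrightarrow>
    (\<forall>p n. Factorial_Ring.prime p \<longrightarrow> y \<in> multiples G (p ^ n) \<longrightarrow> x \<in> multiples G (p ^ n))"
  unfolding char_le_def characteristic_def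
  by (subst enat_le_iff_finite) (auto simp: enat_le_height_iff assms prime_gt_0_nat)

text \<open>\<open>T(G)\<close> is pure in \<open>G\<close>, so heights of torsion elements can be taken in either group.\<close>
lemma height_torsion_part:
  assumes "x \<in> torsion_part G" "p > 0"
  shows "height (G\<lparr>carrier := torsion_part G\<rparr>) p x = height G p x"
proof -
  have "(\<exists>y\<in>torsion_part G. y [^] (p ^ n) = x) \<longleftrightarrow> (\<exists>y\<in>carrier G. y [^] (p ^ n) = x)" for n
    using assms torsion_part_pow_iff[of _ "p ^ n"] subgroup.mem_carrier[OF subgroup_torsion_part]
    by (metis zero_less_power)
  then show ?thesis by (simp add: height_def flip: nat_pow_consistent)
qed

lemma char_subgroup_iff:
  assumes "y \<in> carrier G"
  shows "x \<in> char_subgroup G (characteristic G y) \<longleftrightarrow> x \<in> carrier G \<and>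
    (\<forall>p n. Factorial_Ring.prime p \<longrightarrow> y \<in> multiples G (p ^ n) \<longrightarrow> x \<in> multiples G (p ^ n))"
  unfolding char_subgroup_def using char_le_iff[OF _ assms] by auto

lemma subgroup_char_subgroup:
  assumes "g \<in> carrier G"
  shows "subgroup (char_subgroup G (characteristic G g)) G"
  using subgroup.m_closed[OF subgroup_multiples] subgroup.m_inv_closed[OF subgroup_multiples]
    subgroup.one_closed[OF subgroup_multiples] assms
  by (intro subgroupI) (auto simp: char_subgroup_iff)

lemma char_subgroup_torsion_part:
  "char_subgroup (G\<lparr>carrier := torsion_part G\<rparr>) \<eta> = torsion_part G \<inter> char_subgroup G \<eta>"
  using subgroup.mem_carrier[OF subgroup_torsion_part]
  by (auto simp: char_subgroup_def char_le_def characteristic_def height_torsion_part prime_gt_0_nat)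

end

section \<open>Splitting off a primary part\<close>

text \<open>With \<open>H = p\<^sup>kG\<close>: the group is the direct sum of \<open>\<int>b\<close>, where \<open>p\<^sup>k b = 0\<close>, and of \<open>H\<close>, and \<open>H\<close> is
\<open>p\<close>-divisible (from \<open>p\<^sup>kG = p\<^sup>k\<^sup>+\<^sup>1G\<close>) and without \<open>p\<close>-torsion. A \<open>p\<close>-divisible group without \<open>p\<close>-torsion is
the case \<open>k = 0\<close>, \<open>b = 0\<close>.\<close>
definition splits_at :: "('a, 'b) monoid_scheme \<Rightarrow> nat \<Rightarrow> nat \<Rightarrow> 'a \<Rightarrow> bool" where
  "splits_at G p k b \<longleftrightarrow> b \<in> carrier G \<and> b [^]\<^bsub>G\<^esub> (p ^ k) = \<one>\<^bsub>G\<^esub> \<and>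
     primary_part G p \<inter> multiples G (p ^ k) = {\<one>\<^bsub>G\<^esub>} \<and>
     multiples G (p ^ k) \<subseteq> multiples G (p ^ Suc k) \<and>
     (\<forall>x\<in>carrier G. \<exists>a::int. x \<otimes>\<^bsub>G\<^esub> inv\<^bsub>G\<^esub> (b [^]\<^bsub>G\<^esub> a) \<in> multiples G (p ^ k))"

context comm_group
begin

lemma mult_inv_eq_one_iff:
  "x \<in> carrier G \<Longrightarrow> y \<in> carrier G \<Longrightarrow> x \<otimes> inv y = \<one> \<longleftrightarrow> x = y"
  by (metis inv_closed inv_equality inv_inv r_inv)

lemma mult_inv_cancel [simp]:
  "x \<in> carrier G \<Longrightarrow> y \<in> carrier G \<Longrightarrow> y \<otimes> (x \<otimes> inv y) = x"
  by (metis inv_closed m_assoc m_comm m_closed r_inv r_one)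

lemma mult_inv_pow:
  "x \<in> carrier G \<Longrightarrow> y \<in> carrier G \<Longrightarrow> (x \<otimes> inv y) [^] (n::nat) = x [^] n \<otimes> inv (y [^] n)"
  by (simp add: nat_pow_distrib nat_pow_inv)

lemma nat_pow_int_pow_commute:
  "x \<in> carrier G \<Longrightarrow> (x [^] (i::int)) [^] (n::nat) = (x [^] n) [^] i"
  by (simp add: int_pow_int[symmetric] int_pow_pow mult.commute)

text \<open>Division by powers of \<open>p\<close> is unique in a subgroup without \<open>p\<close>-torsion.\<close>
lemma pow_prime_power_inj:
  assumes H: "subgroup H G" and T: "primary_part G p \<inter> H = {\<one>}"
    and "x \<in> H" "y \<in> H" and eq: "x [^] (p ^ n) = y [^] (p ^ n)"
  shows "x = y"
proof -
  have c: "x \<in> carrier G" "y \<in> carrier G" using subgroup.mem_carrier[OF H] assms(3,4) by auto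
  have "(x \<otimes> inv y) [^] (p ^ n) = \<one>" using c eq by (simp add: mult_inv_pow)
  then have "x \<otimes> inv y \<in> primary_part G p" using c unfolding primary_part_def by blast
  moreover have "x \<otimes> inv y \<in> H" using assms by (simp add: subgroup.m_closed subgroup.m_inv_closed)
  ultimately have "x \<otimes> inv y = \<one>" using T by blast
  then show ?thesis using c mult_inv_eq_one_iff by simp
qed

lemma splits_at_divisible:
  assumes "splits_at G p k b" "h \<in> multiples G (p ^ k)"
  shows "\<exists>h'\<in>multiples G (p ^ k). h' [^] (p ^ n) = h"
proof (induction n)
  case 0
  then show ?case using assms(2) multiples_carrier by auto
next
  case (Suc n)
  then obtain h1 where h1: "h1 \<in> multiples G (p ^ k)" "h1 [^] (p ^ n) = h" by blast
  then have "h1 \<in> multiples G (p ^ Suc k)" using assms(1) by (auto simp: splits_at_def)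
  then obtain y where y: "y \<in> carrier G" "h1 = y [^] (p ^ Suc k)" by (auto simp: multiples_def)
  have "(y [^] (p ^ k)) [^] (p ^ Suc n) = h"
    using y h1(2) by (simp add: nat_pow_pow mult.assoc mult.left_commute mult.commute)
  then show ?case using multiplesI y(1) by blast
qed

lemma splits_at_infinite_height:
  assumes "splits_at G p k b" "h \<in> multiples G (p ^ k)"
  shows "h \<in> multiples G (p ^ n)"
  using splits_at_divisible[OF assms, of n] multiplesI multiples_carrier by blast

text \<open>Let \<open>h\<close> be the height of \<open>g\<close>. If \<open>h \<ge> k\<close>, then \<open>x \<in> p\<^sup>kG\<close> already. Otherwise \<open>g = p\<^sup>h u\<close> and \<open>x = p\<^sup>h v\<close>,
where the component of \<open>u\<close> in \<open>\<int>b\<close> generates \<open>\<int>b\<close>: if \<open>p\<close> divided its coefficient, \<open>g\<close> would have height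
greater than \<open>h\<close>. So \<open>v\<close> is a multiple of \<open>u\<close> modulo \<open>p\<^sup>kG\<close>.\<close>
lemma splits_at_height_le:
  assumes p: "Factorial_Ring.prime p" and S: "splits_at G p k b"
    and g: "g \<in> carrier G"
    and le: "\<And>n. g \<in> multiples G (p ^ n) \<Longrightarrow> x \<in> multiples G (p ^ n)"
  obtains c :: int where "x \<otimes> inv (g [^] c) \<in> multiples G (p ^ k)"
proof (cases "g \<in> multiples G (p ^ k)")
  case True
  have "x \<otimes> inv (g [^] (0::int)) = x" using le[OF True] multiples_carrier by simp
  then show thesis using le[OF True] that[of 0] by simp
next
  case False
  \<comment> \<open>\<open>N = h + 1\<close>, where \<open>h\<close> is the \<open>p\<close>-height of \<open>g\<close>\<close>
  define N where "N = (LEAST n. g \<notin> multiples G (p ^ n))"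
  have gN: "g \<notin> multiples G (p ^ N)" unfolding N_def by (rule LeastI[of _ k]) (fact False)
  have "N \<le> k" unfolding N_def by (rule Least_le) (fact False)
  have "N \<noteq> 0" using gN g by (intro notI) simp
  then obtain h where h: "N = Suc h" by (cases N) auto
  have "g \<in> multiples G (p ^ h)" using not_less_Least[of h "\<lambda>n. g \<notin> multiples G (p ^ n)"] h
    unfolding N_def by auto
  then obtain u v where u: "u \<in> carrier G" "g = u [^] (p ^ h)"
    and v: "v \<in> carrier G" "x = v [^] (p ^ h)"
    using le unfolding multiples_def by blast
  have b: "b \<in> carrier G" "b [^] (p ^ k) = \<one>" using S by (auto simp: splits_at_def)
  obtain \<alpha> \<gamma> :: int where \<alpha>: "u \<otimes> inv (b [^] \<alpha>) \<in> multiples G (p ^ k)"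
    and \<gamma>: "v \<otimes> inv (b [^] \<gamma>) \<in> multiples G (p ^ k)"
    using S u(1) v(1) unfolding splits_at_def by meson
  define y z where y: "y = u \<otimes> inv (b [^] \<alpha>)" and z: "z = v \<otimes> inv (b [^] \<gamma>)"
  have uv: "u = b [^] \<alpha> \<otimes> y" "v = b [^] \<gamma> \<otimes> z" "y \<in> carrier G" "z \<in> carrier G"
    using y z u v b by simp_all
  have "\<not> int p dvd \<alpha>"
  proof
    assume "int p dvd \<alpha>"
    then have "b [^] \<alpha> \<in> multiples G p" using b multiples_int_powI by (auto elim!: dvdE)
    moreover have "y \<in> multiples G p"
      using splits_at_infinite_height[OF S, of y 1] \<alpha> y by simp
    ultimately have "u \<in> multiples G p" using uv(1) subgroup.m_closed[OF subgroup_multiples] by simp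
    then obtain u' where "u' \<in> carrier G" "u = u' [^] p" by (auto simp: multiples_def)
    then have "g \<in> multiples G (p ^ N)"
      using u multiplesI[of u' "p ^ N"] h by (simp add: nat_pow_pow)
    then show False using gN by simp
  qed
  then have "coprime \<alpha> (int (p ^ k))" using p
    by (metis coprime_commute coprime_power_left_iff of_nat_power prime_imp_coprime prime_nat_int_transfer)
  then obtain s t where st: "s * \<alpha> + t * int (p ^ k) = 1" using bezout_int[of \<alpha> "int (p ^ k)"] by auto
  \<comment> \<open>\<open>c \<alpha>\<close> is congruent to \<open>\<gamma>\<close> modulo \<open>p\<^sup>k\<close>, and \<open>p\<^sup>k b = 0\<close>\<close>
  define c where "c = \<gamma> * s"
  have bt: "b [^] (int (p ^ k) * i) = \<one>" for i
    using b int_pow_pow[of b "int (p ^ k)" i] by (simp add: int_pow_int del: of_nat_power)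
  have "\<gamma> - \<alpha> * c = int (p ^ k) * (\<gamma> * t)" 
  proof -
    have "\<gamma> - \<alpha> * c = \<gamma> * (s * \<alpha> + t * int (p ^ k)) - \<alpha> * c" using st by simp
    then show ?thesis by (simp add: c_def algebra_simps)
  qed
  then have one: "b [^] \<gamma> \<otimes> inv (b [^] (\<alpha> * c)) = \<one>"
    using bt b by (metis int_pow_diff)
  have "v \<otimes> inv (u [^] c) = (b [^] \<gamma> \<otimes> inv (b [^] (\<alpha> * c))) \<otimes> (z \<otimes> inv (y [^] c))"
    using uv b by (simp add: int_pow_distrib int_pow_pow inv_mult m_ac)
  also have "\<dots> = z \<otimes> inv (y [^] c)" using uv one by simp
  also have "\<dots> \<in> multiples G (p ^ k)"
    using \<alpha> \<gamma> y z subgroup_multiples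
    by (simp add: subgroup.m_closed subgroup.m_inv_closed subgroup_int_pow_closed)
  finally have "(v \<otimes> inv (u [^] c)) [^] (int (p ^ h)) \<in> multiples G (p ^ k)"
    using subgroup_multiples subgroup_int_pow_closed by blast
  then have "x \<otimes> inv (g [^] c) \<in> multiples G (p ^ k)"
    using u v by (simp add: int_pow_int mult_inv_pow nat_pow_int_pow_commute del: of_nat_power)
  then show thesis by (rule that)
qed

end

section \<open>Quotient divisible groups of rank one\<close>

text \<open>The element-wise form of the conditions on a basis \<open>{e}\<close>: \<open>G/\<int>e\<close> is divisible, that is \<open>G = \<int>e + nG\<close>;
it is torsion; and \<open>G\<close> has no nonzero divisible torsion subgroup.\<close>
locale rank_one_qd = comm_group G for G (structure) +
  fixes e
  assumes e_carrier [simp]: "e \<in> carrier G"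
    and cyclic_mod_multiples:
      "\<And>x n. x \<in> carrier G \<Longrightarrow> n > 0 \<Longrightarrow> \<exists>a::int. x \<otimes> inv (e [^] a) \<in> multiples G n"
    and power_in_base:
      "\<And>x. x \<in> carrier G \<Longrightarrow> \<exists>m::nat. \<exists>r::int. m > 0 \<and> x [^] m = e [^] r"
    and no_divisible_torsion:
      "\<And>D. subgroup D G \<Longrightarrow> D \<subseteq> torsion_part G \<Longrightarrow> divisible_group (G\<lparr>carrier := D\<rparr>) \<Longrightarrow> D = {\<one>}"
begin

text \<open>A \<open>p\<close>-group is divisible by all other primes, so \<open>p\<close>-divisibility makes \<open>D\<close> a divisible torsion subgroup.\<close>
lemma p_divisible_primary_trivial:
  assumes p: "Factorial_Ring.prime p" and D: "subgroup D G" "D \<subseteq> primary_part G p"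
    and div: "\<And>x. x \<in> D \<Longrightarrow> \<exists>y\<in>D. y [^] p = x"
  shows "D = {\<one>}"
proof (rule no_divisible_torsion[OF D(1)])
  show "D \<subseteq> torsion_part G" using D(2) primary_part_subset_torsion[OF p] by blast
  show "divisible_group (G\<lparr>carrier := D\<rparr>)"
  proof (rule divisible_subgroupI[OF D(1)])
    fix q :: nat and x assume q: "Factorial_Ring.prime q" and x: "x \<in> D"
    show "\<exists>y\<in>D. y [^] q = x"
    proof (cases "q = p")
      case True
      then show ?thesis using div x by simp
    next
      case False
      let ?I = "(\<lambda>y. y [^] q) ` D"
      have I: "subgroup ?I G" using D(1) by (rule subgroup_pow_image)
      obtain n where n: "x \<in> carrier G" "x [^] (p ^ n) = \<one>" using x D(2) by (auto simp: primary_part_def)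
      have "coprime (p ^ n) q" using p q False by (simp add: primes_coprime)
      then have "x \<in> ?I"
        using coprime_pow_mem[OF I n(1), of "p ^ n" q] n x subgroup.one_closed[OF I] by simp
      then show ?thesis by auto
    qed
  qed
qed

text \<open>As \<open>T\<^sub>p\<close> is not \<open>p\<close>-divisible and is pure in \<open>G\<close>, it has an element \<open>t\<close> outside \<open>pG\<close>. Since \<open>G/pG\<close> is
cyclic of order \<open>p\<close>, generated by \<open>e\<close>, it is generated by \<open>t\<close> as well, so \<open>G = \<int>t + pG\<close>. Multiplying by
\<open>p\<^sup>k\<close>, where \<open>p\<^sup>k t = 0\<close>, gives \<open>p\<^sup>kG = p\<^sup>k\<^sup>+\<^sup>1G\<close>; the same computation inside \<open>T\<^sub>p\<close> shows that \<open>p\<^sup>kT\<^sub>p\<close> is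
\<open>p\<close>-divisible, hence zero.\<close>
lemma splits_at_if_torsion:
  assumes p: "Factorial_Ring.prime p" and nontriv: "primary_part G p \<noteq> {\<one>}"
  obtains k b where "splits_at G p k b"
proof -
  let ?T = "primary_part G p"
  note Tc = subgroup.mem_carrier[OF subgroup_primary_part]
  have p0: "p > 0" using p by (rule prime_gt_0_nat)
  have "\<not> ?T \<subseteq> multiples G p"
  proof
    assume sub: "?T \<subseteq> multiples G p"
    have "?T = {\<one>}"
    proof (rule p_divisible_primary_trivial[OF p subgroup_primary_part])
      fix x assume x: "x \<in> ?T"
      then obtain y where "y \<in> carrier G" "y [^] p = x" using sub by (auto simp: multiples_def)
      then show "\<exists>y\<in>?T. y [^] p = x" using primary_part_pow_imp[of y p 1] x by auto
    qed simp
    then show False using nontriv by simp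
  qed
  then obtain t where t: "t \<in> ?T" "t \<notin> multiples G p" by blast
  then have tc: "t \<in> carrier G" using Tc by blast
  obtain a :: int where a: "t \<otimes> inv (e [^] a) \<in> multiples G p"
    using cyclic_mod_multiples[OF tc p0] by blast
  have "\<not> int p dvd a"
  proof
    assume "int p dvd a"
    then have "e [^] a \<in> multiples G p" using multiples_int_powI by (auto elim!: dvdE)
    then have "e [^] a \<otimes> (t \<otimes> inv (e [^] a)) \<in> multiples G p"
      using a subgroup.m_closed[OF subgroup_multiples] by blast
    then show False using t(2) tc by simp
  qed
  then have "coprime a (int p)" using p
    by (metis coprime_commute prime_imp_coprime prime_nat_int_transfer)
  then obtain u v where uv: "u * a + v * int p = 1" using bezout_int[of a "int p"] by auto
  \<comment> \<open>\<open>t = a e + y\<close> and \<open>u a + v p = 1\<close>, so \<open>e = u t\<close> and \<open>x = d e = (u d) t\<close> modulo \<open>pG\<close>\<close>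
  have step: "\<exists>c::int. \<exists>z\<in>carrier G. x = t [^] c \<otimes> z [^] p" if x: "x \<in> carrier G" for x
  proof -
    obtain d :: int where d: "x \<otimes> inv (e [^] d) \<in> multiples G p"
      using cyclic_mod_multiples[OF x p0] by blast
    define y where "y = t \<otimes> inv (e [^] a)"
    have y: "y \<in> carrier G" "t = e [^] a \<otimes> y" using tc by (simp_all add: y_def)
    have "d = a * (u * d) + int p * (v * d)"
      using uv by (metis distrib_right mult.assoc mult.commute mult_1)
    then have ed: "e [^] d = e [^] (a * (u * d)) \<otimes> e [^] (int p * (v * d))"
      by (metis e_carrier int_pow_mult)
    have "t [^] (u * d) = e [^] (a * (u * d)) \<otimes> y [^] (u * d)"
      using y by (simp add: int_pow_distrib int_pow_pow)
    then have "e [^] (a * (u * d)) = t [^] (u * d) \<otimes> inv (y [^] (u * d))"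
      using y by (simp add: inv_solve_right)
    then have ed2: "e [^] d = t [^] (u * d) \<otimes> inv (y [^] (u * d)) \<otimes> e [^] (int p * (v * d))"
      using ed by simp
    have "e [^] d \<otimes> q =
        t [^] (u * d) \<otimes> (inv (y [^] (u * d)) \<otimes> e [^] (int p * (v * d)) \<otimes> q)"
      if "q \<in> carrier G" for q
      unfolding ed2 using that y(1) tc by (simp add: m_assoc)
    from this[of "x \<otimes> inv (e [^] d)"] have "x = t [^] (u * d) \<otimes>
        (inv (y [^] (u * d)) \<otimes> e [^] (int p * (v * d)) \<otimes> (x \<otimes> inv (e [^] d)))"
      using x by simp
    moreover have "inv (y [^] (u * d)) \<otimes> e [^] (int p * (v * d)) \<otimes> (x \<otimes> inv (e [^] d)) \<in> multiples G p"
      using a d y_def subgroup_multiples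
      by (simp add: subgroup.m_closed subgroup.m_inv_closed subgroup_int_pow_closed multiples_int_powI)
    ultimately obtain q where q: "q \<in> multiples G p" "x = t [^] (u * d) \<otimes> q" by blast
    then obtain z where "z \<in> carrier G" "q = z [^] p" by (auto simp: multiples_def)
    then show ?thesis using q(2) by blast
  qed
  obtain k where k: "t [^] (p ^ k) = \<one>" using t(1) by (auto simp: primary_part_def)
  have tk: "(t [^] (c::int)) [^] (p ^ k) = \<one>" for c
    using tc k by (simp add: nat_pow_int_pow_commute)
  have cyc: "\<exists>c::int. \<exists>z\<in>carrier G. x = t [^] c \<otimes> z [^] (p ^ n)" if x: "x \<in> carrier G" for x n
  proof (induction n)
    case 0
    have "x = t [^] (0::int) \<otimes> x [^] (p ^ 0)" using x by simp
    then show ?case using x by blast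
  next
    case (Suc n)
    then obtain c :: int and y where y: "y \<in> carrier G" "x = t [^] c \<otimes> y [^] (p ^ n)" by blast
    obtain d :: int and z where z: "z \<in> carrier G" "y = t [^] d \<otimes> z [^] p" using step[OF y(1)] by blast
    have "y [^] (p ^ n) = (t [^] d) [^] (p ^ n) \<otimes> z [^] (p ^ Suc n)"
      using tc z by (simp add: nat_pow_distrib nat_pow_pow)
    also have "(t [^] d) [^] (p ^ n) = t [^] (d * int (p ^ n))"
      using tc by (simp add: int_pow_int[symmetric] int_pow_pow del: of_nat_power)
    finally have "x = t [^] (c + d * int (p ^ n)) \<otimes> z [^] (p ^ Suc n)"
      using tc y(2) z(1) by (simp add: int_pow_mult m_assoc)
    then show ?case using z by blast
  qed
  have stable: "multiples G (p ^ k) \<subseteq> multiples G (p ^ Suc k)"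
  proof
    fix x assume "x \<in> multiples G (p ^ k)"
    then obtain y where y: "y \<in> carrier G" "x = y [^] (p ^ k)" by (auto simp: multiples_def)
    obtain c :: int and z where z: "z \<in> carrier G" "y = t [^] c \<otimes> z [^] p" using step[OF y(1)] by blast
    have "x = z [^] (p ^ Suc k)" using tk tc y z by (simp add: nat_pow_distrib nat_pow_pow)
    then show "x \<in> multiples G (p ^ Suc k)" using multiplesI z by simp
  qed
  have triv: "(\<lambda>y. y [^] (p ^ k)) ` ?T = {\<one>}"
  proof (rule p_divisible_primary_trivial[OF p subgroup_pow_image[OF subgroup_primary_part]])
    show "(\<lambda>y. y [^] (p ^ k)) ` ?T \<subseteq> ?T"
      using subgroup_int_pow_closed[OF subgroup_primary_part, of _ p "int (p ^ k)"]
      by (auto simp: int_pow_int simp del: of_nat_power)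
    fix x assume "x \<in> (\<lambda>y. y [^] (p ^ k)) ` ?T"
    then obtain y where y: "y \<in> ?T" "x = y [^] (p ^ k)" by blast
    obtain c :: int and z where z: "z \<in> carrier G" "y = t [^] c \<otimes> z [^] p"
      using step Tc[OF y(1)] by blast
    have "z [^] p \<in> ?T"
      by (rule subgroup_m_cancel[OF subgroup_primary_part, of "t [^] c"])
         (use t z y subgroup_int_pow_closed[OF subgroup_primary_part] in auto)
    then have zT: "z \<in> ?T" using primary_part_pow_imp[of z p 1] z by simp
    have "x = (z [^] (p ^ k)) [^] p"
      using tk tc y z by (simp add: nat_pow_distrib nat_pow_pow mult.commute)
    then show "\<exists>y\<in>(\<lambda>y. y [^] (p ^ k)) ` ?T. y [^] p = x" using zT by blast
  qed
  have "?T \<inter> multiples G (p ^ k) \<subseteq> {\<one>}"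
  proof
    fix x assume x: "x \<in> ?T \<inter> multiples G (p ^ k)"
    then obtain y where "y \<in> carrier G" "x = y [^] (p ^ k)" by (auto simp: multiples_def)
    then have "x \<in> (\<lambda>y. y [^] (p ^ k)) ` ?T" using x primary_part_pow_imp by blast
    then show "x \<in> {\<one>}" using triv by simp
  qed
  moreover have "\<one> \<in> ?T \<inter> multiples G (p ^ k)"
    using subgroup.one_closed[OF subgroup_primary_part] subgroup.one_closed[OF subgroup_multiples] by blast
  ultimately have disj: "?T \<inter> multiples G (p ^ k) = {\<one>}" by blast
  have "\<exists>c::int. x \<otimes> inv (t [^] c) \<in> multiples G (p ^ k)" if x: "x \<in> carrier G" for x
  proof -
    obtain c :: int and z where z: "z \<in> carrier G" "x = t [^] c \<otimes> z [^] (p ^ k)" using cyc[OF x] by blast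
    then have "x = z [^] (p ^ k) \<otimes> t [^] c" using tc by (simp add: m_comm)
    then have "x \<otimes> inv (t [^] c) = z [^] (p ^ k)" using tc z(1) by (simp add: m_assoc)
    then show ?thesis using multiplesI z(1) by metis
  qed
  then show thesis using that[of k t] tc k disj stable by (simp add: splits_at_def)
qed

text \<open>A nonzero multiple of \<open>g\<close> is a multiple \<open>p\<^sup>i r' e\<close> of \<open>e\<close> with \<open>r'\<close> prime to \<open>p\<close>. Without \<open>p\<close>-torsion, the
infinite height passes from it to \<open>r' e\<close> and so to \<open>e\<close>, and then to all of \<open>G = \<int>e + pG\<close>.\<close>
lemma p_divisible_if_infinite_height:
  assumes p: "Factorial_Ring.prime p" and T: "primary_part G p = {\<one>}"
    and g: "g \<in> carrier G" "g \<notin> torsion_part G" "\<And>n. g \<in> multiples G (p ^ n)"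
  shows "carrier G \<subseteq> multiples G p"
proof -
  obtain m :: nat and r :: int where mr: "m > 0" "g [^] m = e [^] r" using power_in_base[OF g(1)] by blast
  have "r \<noteq> 0" using mr g(1,2) by (auto simp: torsion_part_def dest!: spec[of _ m])
  define N where "N = nat \<bar>r\<bar>"
  have N: "N > 0" "r * sgn r = int N" using \<open>r \<noteq> 0\<close> by (auto simp: N_def sgn_if)
  have eN: "e [^] N = (g [^] m) [^] sgn r"
    using mr(2) N(2) by (simp add: int_pow_pow int_pow_int[symmetric])
  have inf: "e [^] N \<in> multiples G (p ^ n)" for n
    using g(3)[of n] eN subgroup_int_pow_closed[OF subgroup_multiples]
    by (metis int_pow_int)
  obtain i r' where ir: "N = p ^ i * r'" "\<not> p dvd r'" using prime_power_split[OF p N(1)] .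
  \<comment> \<open>one more factor \<open>p\<close> than \<open>N\<close> contains\<close>
  obtain z where z: "z \<in> carrier G" "e [^] N = z [^] (p ^ Suc i)"
    using inf[of "Suc i"] by (auto simp: multiples_def)
  have "(e [^] r') [^] (p ^ i) = (z [^] p) [^] (p ^ i)"
    using z ir by (simp add: nat_pow_pow mult.commute)
  then have "e [^] r' = z [^] p"
    using pow_prime_power_inj[OF subgroup_self, of p] T z(1) by simp
  then have "e [^] r' \<in> multiples G p" using z multiplesI by simp
  moreover have "coprime r' p" using p ir(2) by (metis coprime_commute prime_imp_coprime)
  ultimately have e: "e \<in> multiples G p" using multiples_coprime_pow by simp
  show ?thesis
  proof
    fix x assume x: "x \<in> carrier G"
    then obtain a :: int where "x \<otimes> inv (e [^] a) \<in> multiples G p"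
      using cyclic_mod_multiples prime_gt_0_nat[OF p] by blast
    then have "e [^] a \<otimes> (x \<otimes> inv (e [^] a)) \<in> multiples G p"
      using e subgroup_multiples by (simp add: subgroup.m_closed subgroup_int_pow_closed)
    then show "x \<in> multiples G p" using x by simp
  qed
qed

lemma splits_at_if_p_divisible:
  assumes T: "primary_part G p = {\<one>}" and div: "carrier G \<subseteq> multiples G p"
  shows "splits_at G p 0 \<one>"
  using assms by (auto simp: splits_at_def)

text \<open>Both \<open>g\<close> and \<open>y\<close> have a nonzero multiple in \<open>\<int>e\<close>, and that of \<open>g\<close> is not zero itself.\<close>
lemma rank_one:
  assumes g: "g \<in> carrier G" "g \<notin> torsion_part G" and y: "y \<in> carrier G"
  obtains m :: nat and r :: int where "m > 0" "y [^] m = g [^] r"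
proof -
  obtain a :: nat and s :: int where as: "a > 0" "g [^] a = e [^] s" using power_in_base[OF g(1)] by blast
  obtain b :: nat and t :: int where bt: "b > 0" "y [^] b = e [^] t" using power_in_base[OF y] by blast
  have "s \<noteq> 0" using as g by (auto simp: torsion_part_def dest!: spec[of _ a])
  define N where "N = nat \<bar>s\<bar>"
  have N: "N > 0" "s * sgn s = int N" using \<open>s \<noteq> 0\<close> by (auto simp: N_def sgn_if)
  have "y [^] (b * N) = (e [^] t) [^] (s * sgn s)"
    using y bt(2) N(2) by (simp add: nat_pow_pow[symmetric] int_pow_int)
  also have "\<dots> = (e [^] s) [^] (t * sgn s)" by (simp add: int_pow_pow ac_simps)
  also have "\<dots> = g [^] (int a * (t * sgn s))"
    using as(2)[symmetric] g(1) by (simp add: int_pow_int[symmetric] int_pow_pow)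
  finally show thesis using that[of "b * N"] bt(1) N(1) by simp
qed

text \<open>Divide \<open>g\<close> and \<open>x\<close> by the full power of \<open>p\<close> in \<open>g\<close>; then \<open>g'\<close> is not in \<open>pG\<close>. Take the least \<open>m > 0\<close> with
\<open>m x' = r g'\<close>. If \<open>p\<close> divided \<open>m\<close>, it would divide \<open>r\<close> too, since \<open>g'\<close> is not in \<open>pG\<close>, and the factor \<open>p\<close> could
be cancelled, as \<open>T\<^sub>p = 0\<close>.\<close>
lemma finite_height_multiple:
  assumes p: "Factorial_Ring.prime p" and T: "primary_part G p = {\<one>}"
    and g: "g \<in> carrier G" "g \<notin> torsion_part G" and fin: "g \<notin> multiples G (p ^ N)"
    and x: "x \<in> carrier G" and le: "\<And>n. g \<in> multiples G (p ^ n) \<Longrightarrow> x \<in> multiples G (p ^ n)"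
  obtains m :: nat where "\<not> p dvd m" "x [^] m \<in> generate G {g}"
proof -
  \<comment> \<open>\<open>M = h + 1\<close>, where \<open>h\<close> is the \<open>p\<close>-height of \<open>g\<close>\<close>
  define M where "M = (LEAST n. g \<notin> multiples G (p ^ n))"
  have gM: "g \<notin> multiples G (p ^ M)" unfolding M_def by (rule LeastI[of _ N]) (fact fin)
  have "M \<noteq> 0" using gM g by (intro notI) simp
  then obtain h where h: "M = Suc h" by (cases M) auto
  have "g \<in> multiples G (p ^ h)" using not_less_Least[of h "\<lambda>n. g \<notin> multiples G (p ^ n)"] h
    unfolding M_def by auto
  then obtain g' x' where g': "g' \<in> carrier G" "g = g' [^] (p ^ h)"
    and x': "x' \<in> carrier G" "x = x' [^] (p ^ h)"
    using le unfolding multiples_def by blast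
  have g'p: "g' \<notin> multiples G p"
  proof
    assume "g' \<in> multiples G p"
    then obtain y where "y \<in> carrier G" "g' = y [^] p" by (auto simp: multiples_def)
    then show False using gM g' h multiplesI[of y "p ^ M"] by (simp add: nat_pow_pow)
  qed
  have g't: "g' \<notin> torsion_part G"
    using g(2) g' torsion_part_pow_iff[of g' "p ^ h"] prime_gt_0_nat[OF p] by simp
  let ?P = "\<lambda>m::nat. m > 0 \<and> (\<exists>r::int. x' [^] m = g' [^] r)"
  define m where "m = (LEAST m. ?P m)"
  have least: "m \<le> n" if "?P n" for n unfolding m_def using that by (rule Least_le)
  obtain m0 :: nat and r0 :: int where "m0 > 0" "x' [^] m0 = g' [^] r0"
    using rank_one[OF g'(1) g't x'(1)] .
  then have "?P m0" by auto
  then have "?P m" unfolding m_def by (rule LeastI)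
  then obtain r :: int where mr: "m > 0" "x' [^] m = g' [^] r" by blast
  have "\<not> p dvd m"
  proof
    assume "p dvd m"
    then obtain n where n: "m = n * p" by (metis dvd_div_mult_self)
    then have eq: "(x' [^] n) [^] p = g' [^] r" using mr(2) x'(1) by (simp add: nat_pow_pow)
    have "int p dvd r"
    proof (rule ccontr)
      assume "\<not> int p dvd r"
      then have "coprime r (int p)" using p
        by (metis coprime_commute prime_imp_coprime prime_nat_int_transfer)
      then obtain a c where ac: "a * r + c * int p = 1" using bezout_int[of r "int p"] by auto
      have "g' [^] r \<in> multiples G p" using multiplesI[of "x' [^] n" p] eq x'(1) by simp
      then have "(g' [^] r) [^] a \<otimes> g' [^] (int p * c) \<in> multiples G p"
        using g' subgroup_multiples
        by (simp add: subgroup.m_closed subgroup_int_pow_closed multiples_int_powI)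
      moreover have "(g' [^] r) [^] a \<otimes> g' [^] (int p * c) = g'"
        using g'(1) ac by (simp add: int_pow_pow int_pow_mult[symmetric] mult.commute)
      ultimately show False using g'p by simp
    qed
    then obtain s where "r = s * int p" by (metis dvd_div_mult_self)
    then have "g' [^] r = (g' [^] s) [^] p"
      using g'(1) int_pow_pow[of g' s "int p"] by (simp add: int_pow_int)
    then have "(x' [^] n) [^] (p ^ 1) = (g' [^] s) [^] (p ^ 1)" using eq by simp
    then have "x' [^] n = g' [^] s"
      using pow_prime_power_inj[OF subgroup_self, of p "x' [^] n" "g' [^] s" 1] g'(1) x'(1) T by simp
    then have "m \<le> n" using least[of n] n mr(1) by auto
    moreover have "p > 1" using prime_gt_1_nat[OF p] .
    ultimately show False using n mr(1) by auto
  qed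
  moreover have "x [^] m = (x' [^] m) [^] (p ^ h)"
    using x' by (simp add: nat_pow_pow mult.commute)
  then have "x [^] m = g [^] r" using mr(2) g' by (simp add: nat_pow_int_pow_commute)
  then have "x [^] m \<in> generate G {g}" using g(1) by (auto simp: generate_pow)
  ultimately show thesis using that by blast
qed

text \<open>This is \<open>T(char w) = \<int>w\<close>. At a prime with \<open>T\<^sub>p \<noteq> 0\<close>, \<open>x\<close> is a multiple of \<open>w\<close> up to a torsion element
of the group \<open>p\<^sup>kG\<close>; that element has order prime to \<open>p\<close>.\<close>
lemma torsion_char_subgroup:
  assumes w: "w \<in> torsion_part G"
  shows "torsion_part G \<inter> char_subgroup G (characteristic G w) = generate G {w}"
proof -
  have wc: "w \<in> carrier G" using w subgroup.mem_carrier[OF subgroup_torsion_part] by blast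
  have gen: "subgroup (generate G {w}) G" using wc by (simp add: generate_is_subgroup)
  have "generate G {w} \<subseteq> torsion_part G \<inter> char_subgroup G (characteristic G w)"
    using wc w subgroup_int_pow_closed[OF subgroup_torsion_part] subgroup_int_pow_closed[OF subgroup_multiples]
    by (auto simp: generate_pow char_subgroup_iff)
  moreover have "x \<in> generate G {w}"
    if x: "x \<in> torsion_part G" and h: "x \<in> char_subgroup G (characteristic G w)" for x
  proof (rule mem_subgroup_local_global[OF gen])
    show xc: "x \<in> carrier G" using x subgroup.mem_carrier[OF subgroup_torsion_part] by blast
    fix p :: nat assume p: "Factorial_Ring.prime p"
    show "\<exists>m::nat. \<not> p dvd m \<and> x [^] m \<in> generate G {w}"
    proof (cases "primary_part G p = {\<one>}")
      case True
      obtain m :: nat where "\<not> p dvd m" "x [^] m \<in> primary_part G p" using torsion_splits_prime[OF p x] .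
      then show ?thesis using True generate.one[of G "{w}"] by (metis singletonD)
    next
      case False
      then obtain k b where S: "splits_at G p k b" using splits_at_if_torsion[OF p] by blast
      have hx: "\<And>n. w \<in> multiples G (p ^ n) \<Longrightarrow> x \<in> multiples G (p ^ n)"
        using h p by (auto simp: char_subgroup_iff[OF wc])
      obtain c :: int where c: "x \<otimes> inv (w [^] c) \<in> multiples G (p ^ k)"
        using splits_at_height_le[OF p S wc hx] .
      let ?u = "x \<otimes> inv (w [^] c)"
      have "?u \<in> torsion_part G"
        using x w subgroup_torsion_part
        by (simp add: subgroup.m_closed subgroup.m_inv_closed subgroup_int_pow_closed)
      then obtain m :: nat where m: "\<not> p dvd m" "?u [^] m \<in> primary_part G p"
        using torsion_splits_prime[OF p] by blast
      moreover have "?u [^] m \<in> multiples G (p ^ k)"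
        using subgroup_int_pow_closed[OF subgroup_multiples c, of "int m"] by (simp add: int_pow_int)
      ultimately have "?u [^] m = \<one>" using S by (auto simp: splits_at_def)
      then have "x [^] m = (w [^] c) [^] m"
        using xc wc by (simp add: mult_inv_pow mult_inv_eq_one_iff)
      also have "\<dots> = w [^] (c * int m)" using wc by (simp add: int_pow_pow int_pow_int[symmetric])
      finally have "x [^] m = w [^] (c * int m)" .
      then show ?thesis using m(1) wc by (auto simp: generate_pow)
    qed
  qed
  ultimately show ?thesis by blast
qed

end

section \<open>The basis of a group in QD1\<close>

lemma (in comm_group) finprod_pair:
  assumes "a \<in> carrier G" "b \<in> carrier G" "a \<noteq> b"
  shows "(\<Otimes>c\<in>{a, b}. c [^] (n c :: int)) = a [^] n a \<otimes> b [^] n b"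
proof -
  have "(\<Otimes>c\<in>insert a {b}. c [^] n c) = a [^] n a \<otimes> (\<Otimes>c\<in>{b}. c [^] n c)"
    using assms by (intro finprod_insert) auto
  also have "(\<Otimes>c\<in>insert b {}. c [^] n c) = b [^] n b \<otimes> (\<Otimes>c\<in>{}. c [^] n c)"
    using assms by (intro finprod_insert) auto
  finally show ?thesis using assms by simp
qed

lemma (in comm_group) finprod_single:
  assumes "a \<in> carrier G"
  shows "(\<Otimes>c\<in>{a}. c [^] (n c :: int)) = a [^] n a"
proof -
  have "(\<Otimes>c\<in>insert a {}. c [^] n c) = a [^] n a \<otimes> (\<Otimes>c\<in>{}. c [^] n c)"
    using assms by (intro finprod_insert) auto
  then show ?thesis using assms by simp
qed

lemma int_independentD:
  assumes "int_independent G B" "C \<subseteq> B" "finite C"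
    and "(\<Otimes>\<^bsub>G\<^esub>b\<in>C. b [^]\<^bsub>G\<^esub> (n b :: int)) = \<one>\<^bsub>G\<^esub>" "b \<in> C"
  shows "n b = 0"
  using assms(1)[unfolded int_independent_def, THEN conjunct2, THEN spec, THEN spec, of C n] assms(2-)
  by simp

lemma (in comm_group) int_independent_infinite_order:
  assumes B: "int_independent G B" "b \<in> B" and eq: "b [^] (i::int) = \<one>"
  shows "i = 0"
proof -
  have b: "b \<in> carrier G" using B by (auto simp: int_independent_def)
  then show ?thesis
    using int_independentD[OF B(1), of "{b}" "\<lambda>_. i" b] finprod_single[OF b, of "\<lambda>_. i"] eq B(2) by simp
qed

lemma (in comm_group) int_independent_pair:
  assumes B: "int_independent G B" "b \<in> B" "c \<in> B" "b \<noteq> c" and eq: "b [^] (i::int) = c [^] (j::int)"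
  shows "i = 0"
proof -
  have bc: "b \<in> carrier G" "c \<in> carrier G" using B by (auto simp: int_independent_def)
  define n where "n = (\<lambda>x. if x = b then i else - j)"
  have "(\<Otimes>x\<in>{b, c}. x [^] n x) = \<one>"
    using finprod_pair[OF bc B(4), of n] B(4) eq bc by (simp add: n_def int_pow_neg)
  then have "n b = 0" using int_independentD[OF B(1), of "{b, c}" n b] B(2,3) by simp
  then show ?thesis by (simp add: n_def)
qed

text \<open>The relation between \<open>x\<close> and \<open>b\<close> that maximality provides involves both of them, since each has infinite
order.\<close>
lemma (in comm_group) dependent_on_maximal:
  assumes b: "int_independent G {b}"
    and max: "\<And>x. x \<in> carrier G - {b} \<Longrightarrow> \<not> int_independent G (insert x {b})"
    and x: "x \<in> carrier G" and inf: "\<And>i::int. x [^] i = \<one> \<Longrightarrow> i = 0"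
  obtains m r :: int where "m \<noteq> 0" "r \<noteq> 0" "x [^] m = b [^] r"
proof (cases "x = b")
  case True
  then show thesis using that[of 1 1] by simp
next
  case False
  have bc: "b \<in> carrier G" using b by (auto simp: int_independent_def)
  have binf: "i = 0" if "b [^] (i::int) = \<one>" for i
    using int_independent_infinite_order[OF b _ that] by simp
  have "\<not> int_independent G {x, b}" using max[of x] x False by simp
  then obtain C and n :: "'a \<Rightarrow> int" where C: "C \<subseteq> {x, b}" "(\<Otimes>c\<in>C. c [^] n c) = \<one>" "\<exists>c\<in>C. n c \<noteq> 0"
    unfolding int_independent_def using x bc by auto
  have "C = {x, b}"
  proof (rule ccontr)
    assume "C \<noteq> {x, b}"
    then have "C = {} \<or> C = {x} \<or> C = {b}" using C(1) by blast
    then show False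
      using C(2,3) inf binf finprod_single[OF x, of n] finprod_single[OF bc, of n] by auto
  qed
  then have eq: "x [^] n x \<otimes> b [^] n b = \<one>" using C(2) finprod_pair[OF x bc False, of n] by simp
  then have xb: "x [^] n x = b [^] (- n b)"
    using x bc by (simp add: int_pow_neg) (metis int_pow_closed inv_equality inv_inv inv_closed)
  have "n x \<noteq> 0 \<and> n b \<noteq> 0"
    using C(3) \<open>C = {x, b}\<close> eq x bc inf binf by (metis insertE int_pow_0 int_pow_closed l_one r_one singletonD)
  then show thesis using that[of "n x" "- n b"] xb by simp
qed

text \<open>Torsion-free rank is defined by a maximal independent set \<open>{b}\<close>, which need not be the basis \<open>B\<close> of the
group. Two elements of \<open>B\<close> would both be commensurable with \<open>b\<close>, hence dependent, and \<open>B\<close> cannot be empty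
because \<open>b\<close> has infinite order.\<close>
lemma QD1_imp_singleton_basis:
  fixes G (structure)
  assumes "QD1 G"
  obtains e where "qd_basis G {e}"
proof -
  interpret comm_group G using assms by (simp add: QD1_def quotient_divisible_def)
  obtain B where B: "qd_basis G B" using assms by (auto simp: QD1_def quotient_divisible_def)
  then have ind: "int_independent G B" and tor: "torsion_group (G Mod generate G B)"
    and BG: "B \<subseteq> carrier G"
    by (auto simp: qd_basis_def int_independent_def)
  obtain M where "card M = 1" "int_independent G M"
    "\<forall>x \<in> carrier G - M. \<not> int_independent G (insert x M)"
    using assms unfolding QD1_def has_torsion_free_rank_def by blast
  then obtain b where b: "int_independent G {b}"
    and max: "\<And>x. x \<in> carrier G - {b} \<Longrightarrow> \<not> int_independent G (insert x {b})"
    using card_1_singletonE[of M] by metis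
  have dep: "\<exists>(m::int) (r::int). m \<noteq> 0 \<and> r \<noteq> 0 \<and> x [^] m = b [^] r" if "x \<in> B" for x
  proof -
    have "x \<in> carrier G" using BG that by blast
    from dependent_on_maximal[OF b max this int_independent_infinite_order[OF ind that]]
    show ?thesis by metis
  qed
  have "x = y" if xy: "x \<in> B" "y \<in> B" for x y
  proof (rule ccontr)
    assume ne: "x \<noteq> y"
    obtain m r :: int where m: "m \<noteq> 0" "r \<noteq> 0" "x [^] m = b [^] r" using dep[OF xy(1)] by blast
    obtain m' r' :: int where m': "m' \<noteq> 0" "r' \<noteq> 0" "y [^] m' = b [^] r'" using dep[OF xy(2)] by blast
    have c: "x \<in> carrier G" "y \<in> carrier G" "b \<in> carrier G"
      using xy BG b by (auto simp: int_independent_def)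
    have "x [^] (m * r') = (b [^] r) [^] r'" using m(3) c by (simp add: int_pow_pow[symmetric])
    also have "\<dots> = (b [^] r') [^] r" using c by (simp add: int_pow_pow mult.commute)
    also have "\<dots> = y [^] (m' * r)" using m'(3) c by (simp add: int_pow_pow[symmetric])
    finally have "m * r' = 0" using int_independent_pair[OF ind xy ne] by blast
    then show False using m(1) m'(2) by simp
  qed
  moreover have "B \<noteq> {}"
  proof
    assume "B = {}"
    then have tor1: "torsion_group (G Mod {\<one>})" using tor generate_empty by simp
    interpret N: normal "{\<one>}" G using triv_subgroup subgroup_imp_normal by blast
    have bc: "b \<in> carrier G" using b by (auto simp: int_independent_def)
    then have "{\<one>} #> b \<in> torsion_part (G Mod {\<one>})"
      using tor1 unfolding torsion_group_def by (auto simp: FactGroup_def RCOSETS_def)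
    then obtain n :: nat where n: "n > 0" "({\<one>} #> b) [^]\<^bsub>G Mod {\<one>}\<^esub> n = {\<one>}"
      by (auto simp: torsion_part_def)
    then have "{\<one>} #> (b [^] n) = {\<one>}" using N.FactGroup_pow bc by metis
    then have "b [^] int n = \<one>" using bc by (auto simp: r_coset_def int_pow_int)
    then show False using int_independent_infinite_order[OF b, of b "int n"] n(1) by simp
  qed
  ultimately obtain e where "B = {e}" by blast
  then show thesis using B that by blast
qed

lemma rank_one_qd_if_qd_basis:
  fixes G (structure)
  assumes G: "QD1 G" and e: "qd_basis G {e}"
  shows "rank_one_qd G e"
proof -
  interpret comm_group G using G by (simp add: QD1_def quotient_divisible_def)
  let ?N = "generate G {e}"
  have ec: "e \<in> carrier G" using e by (auto simp: qd_basis_def int_independent_def)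
  then have N: "subgroup ?N G" by (simp add: generate_is_subgroup)
  interpret N: normal ?N G using N subgroup_imp_normal by blast
  have div: "divisible_group (G Mod ?N)" and tor: "torsion_group (G Mod ?N)"
    using e by (auto simp: qd_basis_def)
  have coset: "?N #> x \<in> carrier (G Mod ?N)" if "x \<in> carrier G" for x
    using that by (auto simp: FactGroup_def RCOSETS_def)
  show ?thesis
  proof (unfold_locales)
    show "e \<in> carrier G" by (fact ec)
  next
    fix x and n :: nat assume x: "x \<in> carrier G" and n: "n > 0"
    obtain Y where "Y \<in> carrier (G Mod ?N)" "Y [^]\<^bsub>G Mod ?N\<^esub> n = ?N #> x"
      using div coset[OF x] n unfolding divisible_group_def by blast
    then obtain y where y: "y \<in> carrier G" "?N #> (y [^] n) = ?N #> x"
      using N.FactGroup_pow by (auto simp: FactGroup_def RCOSETS_def)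
    then have "x \<in> ?N #> (y [^] n)" using rcos_self[OF x N] by simp
    then obtain a :: int where "x = e [^] a \<otimes> y [^] n"
      using ec by (auto simp: r_coset_def generate_pow)
    then have "x = y [^] n \<otimes> e [^] a" using y ec by (simp add: m_comm)
    then have "x \<otimes> inv (e [^] a) = y [^] n" using y(1) ec by (simp add: m_assoc)
    then show "\<exists>a::int. x \<otimes> inv (e [^] a) \<in> multiples G n" using multiplesI y(1) by metis
  next
    fix x assume x: "x \<in> carrier G"
    have "?N #> x \<in> torsion_part (G Mod ?N)" using tor coset[OF x] by (simp add: torsion_group_def)
    then obtain m :: nat where m: "m > 0" "(?N #> x) [^]\<^bsub>G Mod ?N\<^esub> m = ?N"
      by (auto simp: torsion_part_def)
    then have "?N #> (x [^] m) = ?N" using N.FactGroup_pow x by metis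
    then have "x [^] m \<in> ?N" using coset_join1 N x by blast
    then show "\<exists>m::nat. \<exists>r::int. m > 0 \<and> x [^] m = e [^] r"
      using m(1) ec by (auto simp: generate_pow)
  next
    fix D assume D: "subgroup D G" "D \<subseteq> torsion_part G" "divisible_group (G\<lparr>carrier := D\<rparr>)"
    have "torsion_group (G\<lparr>carrier := D\<rparr>)"
      using D(2) by (auto simp: torsion_group_def torsion_part_def simp flip: nat_pow_consistent)
    then show "D = {\<one>}" using G D by (auto simp: QD1_def quotient_divisible_def)
  qed
qed

section \<open>Reducedness\<close>

context rank_one_qd
begin

text \<open>Let \<open>x\<close> have infinite height at all primes. Some \<open>y\<close> with \<open>p y = x\<close> has infinite \<open>p\<close>-height: if
\<open>T\<^sub>p = 0\<close>, because division by \<open>p\<close> is unique, and otherwise because \<open>p\<^sup>kG\<close> is \<open>p\<close>-divisible. At the other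
primes the heights of \<open>y\<close> and \<open>p y\<close> agree.\<close>
lemma infinite_height_divisible:
  defines "D \<equiv> {x \<in> carrier G. \<forall>p n. Factorial_Ring.prime p \<longrightarrow> x \<in> multiples G (p ^ n)}"
  shows "subgroup D G" "divisible_group (G\<lparr>carrier := D\<rparr>)"
proof -
  show D: "subgroup D G"
    using subgroup.m_closed[OF subgroup_multiples] subgroup.m_inv_closed[OF subgroup_multiples]
      subgroup.one_closed[OF subgroup_multiples]
    by (intro subgroupI) (auto simp: D_def)
  show "divisible_group (G\<lparr>carrier := D\<rparr>)"
  proof (rule divisible_subgroupI[OF D])
    fix p :: nat and x assume p: "Factorial_Ring.prime p" and x: "x \<in> D"
    have inf: "x \<in> multiples G (p ^ n)" for n using x p by (simp add: D_def)
    have "\<exists>y\<in>carrier G. y [^] p = x \<and> (\<forall>n. y \<in> multiples G (p ^ n))"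
    proof (cases "primary_part G p = {\<one>}")
      case True
      obtain y where y: "y \<in> carrier G" "x = y [^] p"
        using inf[of 1] by (auto simp: multiples_def)
      have "y \<in> multiples G (p ^ n)" for n
      proof -
        obtain z where z: "z \<in> carrier G" "x = z [^] (p ^ Suc n)"
          using inf[of "Suc n"] by (auto simp: multiples_def)
        have "y [^] (p ^ 1) = (z [^] (p ^ n)) [^] (p ^ 1)"
          using y(2) z by (simp add: nat_pow_pow mult.commute)
        then have "y = z [^] (p ^ n)"
          using pow_prime_power_inj[OF subgroup_self, of p y "z [^] (p ^ n)" 1] True y(1) z(1) by simp
        then show ?thesis using multiplesI z(1) by simp
      qed
      then show ?thesis using y by blast
    next
      case False
      then obtain k b where S: "splits_at G p k b" using splits_at_if_torsion[OF p] by blast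
      then obtain y where "y \<in> multiples G (p ^ k)" "y [^] p = x"
        using splits_at_divisible[OF S inf, of 1] by auto
      then show ?thesis using splits_at_infinite_height[OF S] multiples_carrier by blast
    qed
    then obtain y where y: "y \<in> carrier G" "y [^] p = x" "\<And>n. y \<in> multiples G (p ^ n)" by blast
    have "y \<in> multiples G (q ^ n)" if q: "Factorial_Ring.prime q" for q n
    proof (cases "q = p")
      case False
      then have "coprime p (q ^ n)" using p q by (simp add: primes_coprime)
      then show ?thesis using multiples_coprime_pow[OF y(1), of p] y(2) x q by (simp add: D_def)
    qed (simp add: y(3))
    then show "\<exists>y\<in>D. y [^] p = x" using y by (auto simp: D_def)
  qed
qed

text \<open>Let \<open>n g = 0\<close> and let \<open>x\<close> have characteristic at least that of \<open>g\<close>. At every prime, \<open>x\<close> is a multiple of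
\<open>g\<close> up to an element of infinite height there, so \<open>n x\<close> has infinite height everywhere, and \<open>n x = 0\<close>.\<close>
lemma char_subgroup_torsion_if_reduced:
  assumes red: "reduced_group G" and g: "g \<in> torsion_part G"
  shows "char_subgroup G (characteristic G g) \<subseteq> torsion_part G"
proof
  fix x assume x: "x \<in> char_subgroup G (characteristic G g)"
  from g obtain n :: nat where n: "g \<in> carrier G" "n > 0" "g [^] n = \<one>" by (auto simp: torsion_part_def)
  have xc: "x \<in> carrier G"
    and le: "\<And>p j. Factorial_Ring.prime p \<Longrightarrow> g \<in> multiples G (p ^ j) \<Longrightarrow> x \<in> multiples G (p ^ j)"
    using x n(1) by (auto simp: char_subgroup_iff)
  have "x [^] n \<in> multiples G (p ^ j)" if p: "Factorial_Ring.prime p" for p j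
  proof (cases "primary_part G p = {\<one>}")
    case True
    obtain m :: nat where m: "\<not> p dvd m" "g [^] m \<in> primary_part G p" using torsion_splits_prime[OF p g] .
    have "coprime m (p ^ j)" using m(1) p by (metis coprime_commute coprime_power_left_iff prime_imp_coprime)
    then have "x \<in> multiples G (p ^ j)" using le[OF p] coprime_order_multiples[OF n(1)] m(2) True by blast
    then show ?thesis
      using subgroup_int_pow_closed[OF subgroup_multiples, of x _ "int n"] by (simp add: int_pow_int)
  next
    case False
    then obtain k b where S: "splits_at G p k b" using splits_at_if_torsion[OF p] by blast
    obtain c :: int where c: "x \<otimes> inv (g [^] c) \<in> multiples G (p ^ k)"
      using splits_at_height_le[OF p S n(1) le[OF p]] .
    have "(x \<otimes> inv (g [^] c)) [^] n = x [^] n"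
      using n xc by (simp add: mult_inv_pow nat_pow_int_pow_commute)
    then have "x [^] n \<in> multiples G (p ^ k)"
      using subgroup_int_pow_closed[OF subgroup_multiples c, of "int n"] by (simp add: int_pow_int)
    then show ?thesis using splits_at_infinite_height[OF S] by blast
  qed
  then have "x [^] n \<in> {\<one>}"
    using infinite_height_divisible red xc unfolding reduced_group_def by blast
  then show "x \<in> torsion_part G" using xc n(2) by (auto simp: torsion_part_def)
qed

text \<open>The elements of a divisible subgroup have infinite height at all primes, so they lie in \<open>G(char g)\<close> and
are torsion.\<close>
lemma reduced_if_char_subgroup_torsion:
  assumes g: "g \<in> carrier G" and sub: "char_subgroup G (characteristic G g) \<subseteq> torsion_part G"
  shows "reduced_group G"
  unfolding reduced_group_def
proof (intro allI impI, elim conjE)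
  fix D assume D: "subgroup D G" "divisible_group (G\<lparr>carrier := D\<rparr>)"
  have "D \<subseteq> char_subgroup G (characteristic G g)"
  proof
    fix d assume d: "d \<in> D"
    have "d \<in> multiples G (p ^ n)" if "Factorial_Ring.prime p" for p n
    proof -
      have "p ^ n > 0" using prime_gt_0_nat[OF that] by simp
      moreover have "\<forall>x\<in>D. \<forall>n::nat. n > 0 \<longrightarrow> (\<exists>y\<in>D. y [^] n = x)"
        using D(2) by (simp add: divisible_group_def flip: nat_pow_consistent)
      ultimately obtain y where "y \<in> D" "y [^] (p ^ n) = d" using d by blast
      then show ?thesis using multiplesI subgroup.mem_carrier[OF D(1)] by blast
    qed
    then show "d \<in> char_subgroup G (characteristic G g)"
      using subgroup.mem_carrier[OF D(1) d] g by (simp add: char_subgroup_iff)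
  qed
  then show "D = {\<one>}" using no_divisible_torsion[OF D(1) _ D(2)] sub by blast
qed

end

section \<open>Ideals of a ring\<close>

locale rank_one_qd_ring = rank_one_qd G e for G (structure) and e +
  fixes \<mu>
  assumes mu_hom: "\<mu> \<in> hom (tensor_product G G) G"
begin

abbreviation prd (infixl "\<star>" 72) where "x \<star> y \<equiv> ring_prod G \<mu> x y"

lemma prd_closed [simp]: "x \<in> carrier G \<Longrightarrow> y \<in> carrier G \<Longrightarrow> x \<star> y \<in> carrier G"
  using ring_prod_biadditive(1)[OF comm_group_axioms mu_hom] by blast

lemma prd_hom_right: "x \<in> carrier G \<Longrightarrow> (\<lambda>y. x \<star> y) \<in> hom G G"
  and prd_hom_left: "x \<in> carrier G \<Longrightarrow> (\<lambda>y. y \<star> x) \<in> hom G G"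
  using ring_prod_biadditive[OF comm_group_axioms mu_hom] by (auto simp: hom_def)

lemma prd_distrib:
  assumes "x \<in> carrier G" "y \<in> carrier G" "z \<in> carrier G"
  shows "x \<star> (y \<otimes> z) = x \<star> y \<otimes> x \<star> z" "(y \<otimes> z) \<star> x = y \<star> x \<otimes> z \<star> x"
  using ring_prod_biadditive[OF comm_group_axioms mu_hom] assms by auto

lemma prd_int_pow:
  assumes "x \<in> carrier G" "y \<in> carrier G"
  shows "x \<star> (y [^] (i::int)) = (x \<star> y) [^] i" "(x [^] i) \<star> y = (x \<star> y) [^] i"
  using hom_int_pow[OF prd_hom_right[OF assms(1)] assms(2) group_axioms group_axioms]
    hom_int_pow[OF prd_hom_left[OF assms(2)] assms(1) group_axioms group_axioms] by auto

lemma prd_nat_pow: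
  assumes "x \<in> carrier G" "y \<in> carrier G"
  shows "x \<star> (y [^] (n::nat)) = (x \<star> y) [^] n" "(x [^] n) \<star> y = (x \<star> y) [^] n"
  using prd_int_pow[OF assms, of "int n"] by (simp_all add: int_pow_int)

lemma prd_multiples:
  assumes "x \<in> carrier G" "y \<in> multiples G n"
  shows "x \<star> y \<in> multiples G n" "y \<star> x \<in> multiples G n"
  using assms by (auto simp: multiples_def prd_nat_pow)

lemma prd_one: "x \<in> carrier G \<Longrightarrow> x \<star> \<one> = \<one>" "x \<in> carrier G \<Longrightarrow> \<one> \<star> x = \<one>"
  using prd_nat_pow[of x \<one> 0] prd_nat_pow[of \<one> x 0] by simp_all

lemma prd_torsion:
  assumes "x \<in> carrier G" "y \<in> torsion_part G"
  shows "x \<star> y \<in> torsion_part G" "y \<star> x \<in> torsion_part G"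
proof -
  from assms(2) obtain n :: nat where "y \<in> carrier G" "n > 0" "y [^] n = \<one>" by (auto simp: torsion_part_def)
  moreover from this have "(x \<star> y) [^] n = \<one>" "(y \<star> x) [^] n = \<one>"
    using assms(1) prd_nat_pow(1)[of x y n] prd_nat_pow(2)[of y x n] prd_one[of x] by metis+
  ultimately show "x \<star> y \<in> torsion_part G" "y \<star> x \<in> torsion_part G"
    using assms(1) unfolding torsion_part_def by auto
qed

text \<open>Multiplication by a fixed element is an endomorphism, and these do not lower heights.\<close>
lemma char_subgroup_ideal:
  assumes "g \<in> carrier G"
  shows "ring_ideal G \<mu> (char_subgroup G (characteristic G g))"
  using subgroup_char_subgroup[OF assms] prd_multiples assms
  by (auto simp: ring_ideal_def char_subgroup_iff)

lemma torsion_char_subgroup_ideal: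
  assumes "g \<in> carrier G"
  shows "ring_ideal G \<mu> (torsion_part G \<inter> char_subgroup G (characteristic G g))"
  using char_subgroup_ideal[OF assms] prd_torsion subgroups_Inter_pair subgroup_torsion_part
  by (auto simp: ring_ideal_def)

lemma principal_ring_ideal_subset:
  "ring_ideal G \<mu> I \<Longrightarrow> g \<in> I \<Longrightarrow> principal_ring_ideal G \<mu> g \<subseteq> I"
  by (auto simp: principal_ring_ideal_def)

lemma ring_ideal_carrier: "ring_ideal G \<mu> (carrier G)"
  by (simp add: ring_ideal_def subgroup_self)

lemma ring_ideal_principal:
  assumes "g \<in> carrier G"
  shows "ring_ideal G \<mu> (principal_ring_ideal G \<mu> g)" "g \<in> principal_ring_ideal G \<mu> g"
proof -
  have "subgroup (principal_ring_ideal G \<mu> g) G"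
    unfolding principal_ring_ideal_def
    using ring_ideal_carrier assms by (intro subgroups_Inter) (auto simp: ring_ideal_def)
  then show "ring_ideal G \<mu> (principal_ring_ideal G \<mu> g)"
    by (auto simp: ring_ideal_def principal_ring_ideal_def)
  show "g \<in> principal_ring_ideal G \<mu> g" by (simp add: principal_ring_ideal_def)
qed

lemma generate_subset_principal:
  assumes "g \<in> carrier G"
  shows "generate G {g} \<subseteq> principal_ring_ideal G \<mu> g"
  using ring_ideal_principal[OF assms] by (intro generate_subgroup_incl) (auto simp: ring_ideal_def)

lemma principal_ideal_torsion:
  assumes g: "g \<in> torsion_part G"
  shows "principal_ring_ideal G \<mu> g = torsion_part G \<inter> char_subgroup G (characteristic G g)"
proof
  have gc: "g \<in> carrier G" using g subgroup.mem_carrier[OF subgroup_torsion_part] by blast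
  show "principal_ring_ideal G \<mu> g \<subseteq> torsion_part G \<inter> char_subgroup G (characteristic G g)"
    using g gc by (intro principal_ring_ideal_subset torsion_char_subgroup_ideal) (auto simp: char_subgroup_iff)
  show "torsion_part G \<inter> char_subgroup G (characteristic G g) \<subseteq> principal_ring_ideal G \<mu> g"
    using generate_subset_principal[OF gc] torsion_char_subgroup[OF g] by simp
qed

text \<open>If \<open>x \<star> y\<close> has infinite order and \<open>m y = r g\<close>, then \<open>r (x \<star> g) = m (x \<star> y)\<close> has infinite order.\<close>
lemma ex_prd_not_torsion:
  assumes g: "g \<in> carrier G" "g \<notin> torsion_part G" and sq: "\<not> ring_square G \<mu> \<subseteq> torsion_part G"
  obtains x where "x \<in> carrier G" "x \<star> g \<notin> torsion_part G"
proof -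
  have "\<not> {x \<star> y | x y. x \<in> carrier G \<and> y \<in> carrier G} \<subseteq> torsion_part G"
    using sq generate_subgroup_incl[OF _ subgroup_torsion_part] unfolding ring_square_def by blast
  then obtain x y where xy: "x \<in> carrier G" "y \<in> carrier G" "x \<star> y \<notin> torsion_part G" by blast
  obtain m :: nat and r :: int where mr: "m > 0" "y [^] m = g [^] r" using rank_one[OF g xy(2)] .
  have "(x \<star> y) [^] m = (x \<star> g) [^] r"
    using prd_nat_pow(1)[OF xy(1,2), of m] prd_int_pow(1)[OF xy(1) g(1), of r] mr(2) by simp
  moreover have "(x \<star> y) [^] m \<notin> torsion_part G"
    using torsion_part_pow_iff[of "x \<star> y" m] xy mr(1) by simp
  ultimately have "x \<star> g \<notin> torsion_part G"
    using subgroup_int_pow_closed[OF subgroup_torsion_part] by metis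
  then show thesis using that xy(1) by blast
qed

text \<open>With \<open>H = p\<^sup>kG\<close>, the subgroup \<open>H \<star> g\<close> of \<open>I\<close> is \<open>p\<close>-divisible and contains an element \<open>z \<star> g\<close> of
infinite order. A relation \<open>p\<^sup>j m' u = r (z \<star> g)\<close> can be divided by \<open>p\<^sup>j\<close>, on the right by dividing \<open>z\<close>
within \<open>H\<close>, because \<open>H\<close> has no \<open>p\<close>-torsion.\<close>
lemma splits_at_multiples_in_ideal:
  assumes p: "Factorial_Ring.prime p" and S: "splits_at G p k b"
    and I: "ring_ideal G \<mu> I" "g \<in> I" "g \<in> carrier G"
    and x0: "x0 \<in> carrier G" "x0 \<star> g \<notin> torsion_part G"
    and u: "u \<in> multiples G (p ^ k)"
  obtains m :: nat where "\<not> p dvd m" "u [^] m \<in> I"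
proof -
  let ?H = "multiples G (p ^ k)"
  have uc: "u \<in> carrier G" using u multiples_carrier by blast
  \<comment> \<open>moves \<open>x0\<close> into \<open>p\<^sup>kG\<close> and keeps its product with \<open>g\<close> of infinite order\<close>
  define z where "z = x0 [^] (p ^ k)"
  have z: "z \<in> ?H" "z \<in> carrier G" using x0(1) multiplesI by (auto simp: z_def)
  have "z \<star> g \<notin> torsion_part G"
    using torsion_part_pow_iff[of "x0 \<star> g" "p ^ k"] x0 I(3) prime_gt_0_nat[OF p]
    by (simp add: z_def prd_nat_pow)
  then obtain m :: nat and r :: int where mr: "m > 0" "u [^] m = (z \<star> g) [^] r"
    using rank_one[of "z \<star> g" u] z(2) I(3) uc by auto
  obtain j m' where m': "m = p ^ j * m'" "\<not> p dvd m'" using prime_power_split[OF p mr(1)] .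
  obtain z' where z': "z' \<in> ?H" "z' [^] (p ^ j) = z" using splits_at_divisible[OF S z(1)] by blast
  then have z'c: "z' \<in> carrier G" using multiples_carrier by blast
  have "(u [^] m') [^] (p ^ j) = ((z' \<star> g) [^] r) [^] (p ^ j)"
    using mr(2) m'(1) uc z'c I(3) prd_nat_pow(2)[of z' g "p ^ j"]
    by (simp add: nat_pow_pow mult.commute nat_pow_int_pow_commute z'(2))
  moreover have "u [^] m' \<in> ?H" "(z' \<star> g) [^] r \<in> ?H"
    using subgroup_int_pow_closed[OF subgroup_multiples u, of "int m'"]
      subgroup_int_pow_closed[OF subgroup_multiples prd_multiples(2)[OF I(3) z'(1)]]
    by (simp_all add: int_pow_int)
  ultimately have "u [^] m' = (z' \<star> g) [^] r"
    using pow_prime_power_inj[OF subgroup_multiples, of p "p ^ k"] S by (simp add: splits_at_def)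
  moreover have "(z' \<star> g) [^] r \<in> I"
    using I z'c by (auto simp: ring_ideal_def intro: subgroup_int_pow_closed)
  ultimately show thesis using that m'(2) by simp
qed

text \<open>At a prime where \<open>G\<close> splits, \<open>x - c g \<in> p\<^sup>kG\<close> for some \<open>c\<close>, and a multiple of it by a number prime to
\<open>p\<close> lies in the ideal. At the others \<open>T\<^sub>p = 0\<close> and \<open>G \<noteq> pG\<close>, so \<open>g\<close> has finite height and such a multiple of
\<open>x\<close> is already in \<open>\<int>g\<close>.\<close>
lemma principal_ideal_nontorsion:
  assumes g: "g \<in> carrier G" "g \<notin> torsion_part G" and sq: "\<not> ring_square G \<mu> \<subseteq> torsion_part G"
  shows "principal_ring_ideal G \<mu> g = char_subgroup G (characteristic G g)"
proof
  let ?I = "principal_ring_ideal G \<mu> g"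
  note I = ring_ideal_principal[OF g(1)]
  have Isub: "subgroup ?I G" using I by (simp add: ring_ideal_def)
  show "?I \<subseteq> char_subgroup G (characteristic G g)"
    using g by (intro principal_ring_ideal_subset char_subgroup_ideal) (auto simp: char_subgroup_iff)
  obtain x0 where x0: "x0 \<in> carrier G" "x0 \<star> g \<notin> torsion_part G" using ex_prd_not_torsion[OF g sq] .
  show "char_subgroup G (characteristic G g) \<subseteq> ?I"
  proof
    fix x assume "x \<in> char_subgroup G (characteristic G g)"
    then have x: "x \<in> carrier G"
      and le: "\<And>p n. Factorial_Ring.prime p \<Longrightarrow> g \<in> multiples G (p ^ n) \<Longrightarrow> x \<in> multiples G (p ^ n)"
      using g(1) by (auto simp: char_subgroup_iff)
    show "x \<in> ?I"
    proof (rule mem_subgroup_local_global[OF Isub x])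
      fix p :: nat assume p: "Factorial_Ring.prime p"
      show "\<exists>m::nat. \<not> p dvd m \<and> x [^] m \<in> ?I"
      proof (cases "\<exists>k b. splits_at G p k b")
        case True
        then obtain k b where S: "splits_at G p k b" by blast
        obtain c :: int where c: "x \<otimes> inv (g [^] c) \<in> multiples G (p ^ k)"
          using splits_at_height_le[OF p S g(1) le[OF p]] .
        let ?u = "x \<otimes> inv (g [^] c)"
        obtain m :: nat where m: "\<not> p dvd m" "?u [^] m \<in> ?I"
          using splits_at_multiples_in_ideal[OF p S I g(1) x0 c] .
        have "(g [^] c) [^] int m \<otimes> ?u [^] m \<in> ?I"
          using m(2) I(2) Isub by (simp add: subgroup.m_closed subgroup_int_pow_closed)
        also have "(g [^] c) [^] int m \<otimes> ?u [^] m = x [^] m"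
          using x g(1) by (simp add: int_pow_int mult_inv_pow)
        finally show ?thesis using m(1) by blast
      next
        case False
        have T: "primary_part G p = {\<one>}"
        proof (rule ccontr)
          assume "primary_part G p \<noteq> {\<one>}"
          from splits_at_if_torsion[OF p this] obtain k b where "splits_at G p k b" .
          then show False using False by blast
        qed
        have "\<not> carrier G \<subseteq> multiples G p" using False splits_at_if_p_divisible[OF T] by blast
        then obtain N where N: "g \<notin> multiples G (p ^ N)"
          using p_divisible_if_infinite_height[OF p T g] by blast
        obtain m :: nat where "\<not> p dvd m" "x [^] m \<in> generate G {g}"
          using finite_height_multiple[OF p T g N x le[OF p]] .
        then show ?thesis using generate_subset_principal[OF g(1)] by blast
      qed
    qed
  qed
qed

end

section \<open>The case of a torsion square\<close>

text \<open>As \<open>T\<^sub>p\<close> is pure in \<open>G\<close>, \<open>p\<^sup>nT\<^sub>p\<close> is the intersection of \<open>T\<^sub>p\<close> and \<open>p\<^sup>nG\<close>. This form covers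
finite and infinite heights alike.\<close>
lemma (in comm_group) mem_prime_power_multiple_primary:
  assumes p: "Factorial_Ring.prime p" and w: "w \<in> carrier G"
  shows "y \<in> prime_power_multiple G p (height G p w) (primary_part G p) \<longleftrightarrow>
    y \<in> primary_part G p \<and> (\<forall>n. w \<in> multiples G (p ^ n) \<longrightarrow> y \<in> multiples G (p ^ n))"
proof -
  have pow: "y \<in> (\<lambda>x. x [^] (p ^ n)) ` primary_part G p \<longleftrightarrow> y \<in> primary_part G p \<and> y \<in> multiples G (p ^ n)" for n
  proof
    assume "y \<in> (\<lambda>x. x [^] (p ^ n)) ` primary_part G p"
    then obtain x where x: "x \<in> primary_part G p" "y = x [^] (p ^ n)" by blast
    then have "x \<in> carrier G" using subgroup.mem_carrier[OF subgroup_primary_part] by blast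
    then show "y \<in> primary_part G p \<and> y \<in> multiples G (p ^ n)"
      using x multiplesI subgroup_int_pow_closed[OF subgroup_primary_part x(1), of "int (p ^ n)"]
      by (simp add: int_pow_int del: of_nat_power)
  next
    assume y: "y \<in> primary_part G p \<and> y \<in> multiples G (p ^ n)"
    then obtain x where "x \<in> carrier G" "y = x [^] (p ^ n)" by (auto simp: multiples_def)
    then show "y \<in> (\<lambda>x. x [^] (p ^ n)) ` primary_part G p" using y primary_part_pow_imp by blast
  qed
  have ht: "w \<in> multiples G (p ^ n) \<longleftrightarrow> enat n \<le> height G p w" for n
    using enat_le_height_iff[OF w prime_gt_0_nat[OF p]] by simp
  show ?thesis
  proof (cases "height G p w")
    case (enat h)
    have "y \<in> multiples G (p ^ h) \<longleftrightarrow> (\<forall>n\<le>h. y \<in> multiples G (p ^ n))"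
      using multiples_dvd_mono[OF le_imp_power_dvd] by blast
    then show ?thesis using pow ht enat by (simp add: prime_power_multiple_def)
  next
    case infinity
    then show ?thesis using pow ht by (auto simp: prime_power_multiple_def)
  qed
qed

context rank_one_qd
begin

text \<open>The summands are the primary components of \<open>T(char w) = \<int>w\<close>, since elements of \<open>T\<^sub>p\<close> have infinite height
at the primes other than \<open>p\<close>.\<close>
lemma internal_direct_sum_prime_power_multiples:
  assumes w: "w \<in> torsion_part G"
  shows "internal_direct_sum G {p. Factorial_Ring.prime p}
    (\<lambda>p. prime_power_multiple G p (height G p w) (primary_part G p)) (generate G {w})"
proof -
  have wc: "w \<in> carrier G" using w subgroup.mem_carrier[OF subgroup_torsion_part] by blast
  define A where "A = (\<lambda>p. prime_power_multiple G p (height G p w) (primary_part G p))"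
  have A_iff: "y \<in> A p \<longleftrightarrow>
      y \<in> primary_part G p \<and> (\<forall>n. w \<in> multiples G (p ^ n) \<longrightarrow> y \<in> multiples G (p ^ n))"
    if "Factorial_Ring.prime p" for y p
    unfolding A_def using mem_prime_power_multiple_primary[OF that wc] .
  have sub: "subgroup (A p) G" if p: "Factorial_Ring.prime p" for p
  proof (rule subgroupI)
    have "\<one> \<in> A p"
      using subgroup.one_closed[OF subgroup_multiples] subgroup.one_closed[OF subgroup_primary_part]
      by (simp add: A_iff[OF p])
    then show "A p \<noteq> {}" by blast
  qed (use subgroup.m_closed[OF subgroup_multiples] subgroup.m_inv_closed[OF subgroup_multiples]
      subgroup.m_closed[OF subgroup_primary_part] subgroup.m_inv_closed[OF subgroup_primary_part]
      subgroup.mem_carrier[OF subgroup_primary_part] in \<open>auto simp: A_iff[OF p]\<close>)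
  let ?P = "{p::nat. Factorial_Ring.prime p}"
  have Ac: "(\<Union>p\<in>?P. A p) \<subseteq> carrier G" using subgroup.subset[OF sub] by blast
  have gen: "generate G {w} = generate G (\<Union>p\<in>?P. A p)"
  proof
    have S: "subgroup (generate G (\<Union>p\<in>?P. A p)) G" using Ac by (rule generate_is_subgroup)
    have "w \<in> generate G (\<Union>p\<in>?P. A p)"
    proof (rule mem_subgroup_local_global[OF S wc])
      fix p :: nat assume p: "Factorial_Ring.prime p"
      obtain m :: nat where m: "\<not> p dvd m" "w [^] m \<in> primary_part G p" using torsion_splits_prime[OF p w] .
      have "w [^] m \<in> multiples G (p ^ n)" if "w \<in> multiples G (p ^ n)" for n
        using subgroup_int_pow_closed[OF subgroup_multiples that, of "int m"] by (simp add: int_pow_int)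
      then have "w [^] m \<in> A p" using m(2) A_iff[OF p] by blast
      then show "\<exists>m::nat. \<not> p dvd m \<and> w [^] m \<in> generate G (\<Union>p\<in>?P. A p)"
        using m(1) p generate.incl[of "w [^] m" "\<Union>p\<in>?P. A p" G] by auto
    qed
    then show "generate G {w} \<subseteq> generate G (\<Union>p\<in>?P. A p)"
      using S by (intro generate_subgroup_incl) auto
  next
    have "A p \<subseteq> generate G {w}" if p: "Factorial_Ring.prime p" for p
    proof
      fix y assume y: "y \<in> A p"
      then have yT: "y \<in> primary_part G p" using A_iff[OF p] by blast
      then obtain n :: nat where n: "y \<in> carrier G" "y [^] (p ^ n) = \<one>" by (auto simp: primary_part_def)
      have "y \<in> multiples G (q ^ j)" if q: "Factorial_Ring.prime q" "w \<in> multiples G (q ^ j)" for q j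
      proof (cases "q = p")
        case True
        then show ?thesis using y q A_iff[OF p] by blast
      next
        case False
        then have "coprime (p ^ n) (q ^ j)" using p q(1) by (simp add: primes_coprime)
        then show ?thesis using coprime_order_multiples n by blast
      qed
      then show "y \<in> generate G {w}"
        using torsion_char_subgroup[OF w] yT primary_part_subset_torsion[OF p] n(1)
          char_subgroup_iff[OF wc, of y] by blast
    qed
    then show "generate G (\<Union>p\<in>?P. A p) \<subseteq> generate G {w}"
      using wc by (intro generate_subgroup_incl generate_is_subgroup) auto
  qed
  have disj: "A p \<inter> generate G (\<Union>q\<in>?P - {p}. A q) = {\<one>}" if p: "Factorial_Ring.prime p" for p
  proof -
    \<comment> \<open>the elements of order prime to \<open>p\<close>, among which are all other summands\<close>
    let ?C = "{z \<in> carrier G. \<exists>m::nat. \<not> p dvd m \<and> z [^] m = \<one>}"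
    have C: "subgroup ?C G"
    proof (rule subgroupI)
      show "?C \<noteq> {}" using p not_prime_unit by (auto intro!: exI[of _ \<one>] exI[of _ "1::nat"])
      show "inv a \<in> ?C" if "a \<in> ?C" for a using that by (auto simp: nat_pow_inv)
      show "a \<otimes> b \<in> ?C" if "a \<in> ?C" "b \<in> ?C" for a b
      proof -
        from that obtain m n :: nat where mn: "a \<in> carrier G" "b \<in> carrier G"
          "\<not> p dvd m" "\<not> p dvd n" "a [^] m = \<one>" "b [^] n = \<one>" by auto
        then have "(a \<otimes> b) [^] (m * n) = \<one>" "\<not> p dvd m * n"
          using p by (simp_all add: nat_pow_distrib pow_mult_one prime_dvd_mult_iff)
        then show ?thesis using mn(1,2) by blast
      qed
    qed auto
    have "A q \<subseteq> ?C" if q: "q \<in> ?P - {p}" for q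
    proof
      fix y assume "y \<in> A q"
      then obtain n :: nat where "y \<in> carrier G" "y [^] (q ^ n) = \<one>"
        using A_iff[of q] q by (auto simp: primary_part_def)
      moreover have "\<not> p dvd q ^ n"
        using p q by (metis DiffE mem_Collect_eq prime_dvd_power primes_dvd_imp_eq singletonI)
      ultimately show "y \<in> ?C" by blast
    qed
    then have "generate G (\<Union>q\<in>?P - {p}. A q) \<subseteq> ?C"
      using C by (intro generate_subgroup_incl) auto
    then have "A p \<inter> generate G (\<Union>q\<in>?P - {p}. A q) \<subseteq> {\<one>}"
      using A_iff[OF p] primary_part_coprime_pow[OF p] by blast
    moreover have "\<one> \<in> A p" using sub[OF p] subgroup.one_closed by blast
    ultimately show ?thesis using generate.one by blast
  qed
  show ?thesis
    unfolding internal_direct_sum_def A_def[symmetric]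
  proof (intro conjI)
    show "\<forall>i\<in>?P. subgroup (A i) G" using sub by blast
    show "generate G {w} = generate G (\<Union>i\<in>?P. A i)" by (fact gen)
    show "\<forall>i\<in>?P. A i \<inter> generate G (\<Union>j\<in>?P - {i}. A j) = {\<one>}" using disj by blast
  qed
qed

end

context rank_one_qd_ring
begin

lemma prd_mod_base:
  assumes "x \<in> carrier G" "y \<in> carrier G" and a: "x \<otimes> inv (e [^] (a::int)) \<in> multiples G n"
  shows "x \<star> y \<in> multiples G n \<longleftrightarrow> (e \<star> y) [^] a \<in> multiples G n"
    and "y \<star> x \<in> multiples G n \<longleftrightarrow> (y \<star> e) [^] a \<in> multiples G n"
proof -
  define u where "u = x \<otimes> inv (e [^] a)"
  have u: "u \<in> carrier G" "x = e [^] a \<otimes> u" "u \<in> multiples G n" using assms by (simp_all add: u_def)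
  have uy: "u \<star> y \<in> multiples G n" "y \<star> u \<in> multiples G n" using prd_multiples[OF assms(2) u(3)] by auto
  have "x \<star> y = (u \<star> y) \<otimes> (e \<star> y) [^] a" "y \<star> x = (y \<star> u) \<otimes> (y \<star> e) [^] a"
    using u(1,2) assms(2) by (simp_all add: prd_distrib prd_int_pow m_comm)
  then show "x \<star> y \<in> multiples G n \<longleftrightarrow> (e \<star> y) [^] a \<in> multiples G n"
    and "y \<star> x \<in> multiples G n \<longleftrightarrow> (y \<star> e) [^] a \<in> multiples G n"
    using uy subgroup_m_cancel[OF subgroup_multiples] subgroup.m_closed[OF subgroup_multiples] assms(2)
    by (metis e_carrier int_pow_closed prd_closed)+
qed

text \<open>Modulo \<open>nG\<close> all elements are multiples of \<open>e\<close>: if \<open>g = c e\<close> and \<open>x = a e\<close> there, then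
\<open>g \<star> e = c (e \<star> e) = e \<star> g\<close>, and \<open>x \<star> g\<close> and \<open>g \<star> x\<close> are both equal to \<open>a (g \<star> e)\<close>.\<close>
lemma prd_base_multiples:
  assumes g: "g \<in> carrier G" and n: "n > 0" and ge: "g \<star> e \<in> multiples G n" and x: "x \<in> carrier G"
  shows "x \<star> g \<in> multiples G n" "g \<star> x \<in> multiples G n"
proof -
  obtain c :: int where c: "g \<otimes> inv (e [^] c) \<in> multiples G n" using cyclic_mod_multiples[OF g n] by blast
  obtain a :: int where a: "x \<otimes> inv (e [^] a) \<in> multiples G n" using cyclic_mod_multiples[OF x n] by blast
  have "e \<star> g \<in> multiples G n"
    using ge prd_mod_base(1)[OF g e_carrier c] prd_mod_base(2)[OF g e_carrier c] by simp
  then show "x \<star> g \<in> multiples G n" "g \<star> x \<in> multiples G n"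
    using prd_mod_base[OF x g a] ge subgroup_int_pow_closed[OF subgroup_multiples] by auto
qed

text \<open>All products with the factor \<open>g\<close> are torsion elements whose heights are at least those of
\<open>w = g \<star> e\<close>, so they lie in \<open>T(char w) = \<int>w\<close>. Since \<open>\<int>w\<close> is an ideal, so is \<open>\<int>w + \<int>g\<close>.\<close>
lemma principal_ideal_torsion_square:
  assumes g: "g \<in> carrier G" and sq: "ring_square G \<mu> \<subseteq> torsion_part G"
  shows "principal_ring_ideal G \<mu> g = generate G {g \<star> e} <#> generate G {g}"
proof
  let ?w = "g \<star> e" and ?I = "principal_ring_ideal G \<mu> g"
  let ?J = "generate G {?w} <#> generate G {g}"
  note I = ring_ideal_principal[OF g]
  have tor: "x \<star> y \<in> torsion_part G" if "x \<in> carrier G" "y \<in> carrier G" for x y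
  proof -
    have "x \<star> y \<in> ring_square G \<mu>" unfolding ring_square_def using that by (intro generate.incl) blast
    then show ?thesis using sq by blast
  qed
  have w: "?w \<in> torsion_part G" "?w \<in> carrier G" using tor g by simp_all
  note Zw = torsion_char_subgroup[OF w(1)]
  have sw: "subgroup (generate G {?w}) G" and sg: "subgroup (generate G {g}) G"
    using w(2) g by (simp_all add: generate_is_subgroup)
  have Zwid: "ring_ideal G \<mu> (generate G {?w})" using torsion_char_subgroup_ideal[OF w(2)] Zw by simp
  have gx: "x \<star> g \<in> generate G {?w}" "g \<star> x \<in> generate G {?w}" if x: "x \<in> carrier G" for x
  proof -
    have "x \<star> g \<in> multiples G (p ^ n)" "g \<star> x \<in> multiples G (p ^ n)"
      if "Factorial_Ring.prime p" "?w \<in> multiples G (p ^ n)" for p n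
      using prd_base_multiples[OF g _ that(2) x] prime_gt_0_nat[OF that(1)] by simp_all
    then show "x \<star> g \<in> generate G {?w}" "g \<star> x \<in> generate G {?w}"
      using Zw tor x g char_subgroup_iff[OF w(2)] by auto
  qed
  have J: "subgroup ?J G" using mult_subgroups[OF sw sg] .
  have sub: "generate G {?w} \<subseteq> ?J"
  proof
    fix s assume s: "s \<in> generate G {?w}"
    then have "s \<otimes> \<one> \<in> ?J" using generate.one by (auto simp: set_mult_def)
    then show "s \<in> ?J" using subgroup.mem_carrier[OF sw s] by simp
  qed
  have "ring_ideal G \<mu> ?J"
    unfolding ring_ideal_def
  proof (intro conjI ballI J)
    fix a x assume a: "a \<in> ?J" and x: "x \<in> carrier G"
    obtain s and i :: int where s: "s \<in> generate G {?w}" "a = s \<otimes> g [^] i"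
      using a g by (auto simp: set_mult_def generate_pow[OF g])
    have sc: "s \<in> carrier G" using subgroup.mem_carrier[OF sw s(1)] .
    have "x \<star> s \<otimes> (x \<star> g) [^] i \<in> generate G {?w}" "s \<star> x \<otimes> (g \<star> x) [^] i \<in> generate G {?w}"
      using Zwid s(1) x gx[OF x] subgroup.m_closed[OF sw] subgroup_int_pow_closed[OF sw]
      by (auto simp: ring_ideal_def)
    then show "x \<star> a \<in> ?J" "a \<star> x \<in> ?J"
      using sub s(2) sc g x by (auto simp: prd_distrib prd_int_pow)
  qed
  moreover have "g \<in> ?J"
  proof -
    have "\<one> \<otimes> g \<in> ?J"
      using generate.one[of G "{?w}"] generate.incl[of g "{g}" G] unfolding set_mult_def by blast
    then show ?thesis using g by simp
  qed
  ultimately show "?I \<subseteq> ?J" by (rule principal_ring_ideal_subset)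
  show "?J \<subseteq> ?I"
  proof
    fix a assume "a \<in> ?J"
    then obtain s t where st: "s \<in> generate G {?w}" "t \<in> generate G {g}" "a = s \<otimes> t"
      by (auto simp: set_mult_def)
    have "?w \<in> ?I" using I by (simp add: ring_ideal_def)
    then have "generate G {?w} \<subseteq> ?I"
      using I(1) by (intro generate_subgroup_incl) (auto simp: ring_ideal_def)
    then show "a \<in> ?I"
      using st generate_subset_principal[OF g] I(1) by (auto simp: ring_ideal_def intro: subgroup.m_closed)
  qed
qed

end

theorem theorem2p4:
  fixes G :: "('a, 'b) monoid_scheme"
    and \<mu> :: "('a \<times> 'a \<Rightarrow>\<^sub>0 int) set \<Rightarrow> 'a"
    and g :: 'a
  assumes "QD1 G"
    and "\<mu> \<in> hom (tensor_product G G) G"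
    and "g \<in> carrier G"
  shows
    "(g \<in> torsion_part G \<longrightarrow>
        principal_ring_ideal G \<mu> g =
          char_subgroup (G\<lparr>carrier := torsion_part G\<rparr>) (characteristic G g) \<and>
        (char_subgroup (G\<lparr>carrier := torsion_part G\<rparr>) (characteristic G g) =
           char_subgroup G (characteristic G g) \<longleftrightarrow> RQD1 G)) \<and>
     (g \<notin> torsion_part G \<and> \<not> ring_square G \<mu> \<subseteq> torsion_part G \<longrightarrow>
        principal_ring_ideal G \<mu> g = char_subgroup G (characteristic G g)) \<and>
     (g \<notin> torsion_part G \<and> ring_square G \<mu> \<subseteq> torsion_part G \<longrightarrow>
        (\<forall>e. qd_basis G {e} \<longrightarrow>
           (\<exists>S. internal_direct_sum G {p. Factorial_Ring.prime p}
                  (\<lambda>p. prime_power_multiple G p (height G p (ring_prod G \<mu> g e))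
                         (primary_part G p)) S \<and>
                principal_ring_ideal G \<mu> g = S <#>\<^bsub>G\<^esub> generate G {g})))"
proof (intro conjI impI allI)
  interpret comm_group G using assms(1) by (simp add: QD1_def quotient_divisible_def)
  have ring: "rank_one_qd_ring G e \<mu>" if "qd_basis G {e}" for e
    using rank_one_qd_if_qd_basis[OF assms(1) that] assms(2)
    by (simp add: rank_one_qd_ring_def rank_one_qd_ring_axioms_def)
  obtain e where e: "qd_basis G {e}" using QD1_imp_singleton_basis[OF assms(1)] .
  interpret rank_one_qd_ring G e \<mu> using ring[OF e] .
  {
    assume g: "g \<in> torsion_part G"
    show "principal_ring_ideal G \<mu> g =
        char_subgroup (G\<lparr>carrier := torsion_part G\<rparr>) (characteristic G g)"
      using principal_ideal_torsion[OF g] by (simp add: char_subgroup_torsion_part)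
    show "char_subgroup (G\<lparr>carrier := torsion_part G\<rparr>) (characteristic G g) =
        char_subgroup G (characteristic G g) \<longleftrightarrow> RQD1 G"
      using char_subgroup_torsion_if_reduced[OF _ g] reduced_if_char_subgroup_torsion[OF assms(3)] assms(1)
      by (auto simp: char_subgroup_torsion_part RQD1_def)
  }
  show "principal_ring_ideal G \<mu> g = char_subgroup G (characteristic G g)"
    if "g \<notin> torsion_part G \<and> \<not> ring_square G \<mu> \<subseteq> torsion_part G"
    using principal_ideal_nontorsion[OF assms(3)] that by blast
  fix e' assume g: "g \<notin> torsion_part G \<and> ring_square G \<mu> \<subseteq> torsion_part G" and e': "qd_basis G {e'}"
  interpret E: rank_one_qd_ring G e' \<mu> using ring[OF e'] .
  have "ring_prod G \<mu> g e' \<in> ring_square G \<mu>"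
    unfolding ring_square_def using assms(3) E.e_carrier by (intro generate.incl) blast
  then have "ring_prod G \<mu> g e' \<in> torsion_part G" using g by blast
  from E.internal_direct_sum_prime_power_multiples[OF this] E.principal_ideal_torsion_square[OF assms(3)] g
  show "\<exists>S. internal_direct_sum G {p. Factorial_Ring.prime p}
             (\<lambda>p. prime_power_multiple G p (height G p (ring_prod G \<mu> g e')) (primary_part G p)) S \<and>
           principal_ring_ideal G \<mu> g = S <#>\<^bsub>G\<^esub> generate G {g}"
    by blast
qed

end
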